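(* Let $n\ge 6$ and let $\mathcal{N}=\bigoplus_{i=1}^n\mathcal{L}_i$, where $\mathcal{L}_i=V_{\lambda_i}$ and $$(\lambda_1,\lambda_2,\lambda_3,\lambda_4,\lambda_5,\lambda_6,\lambda_7,\dots,\lambda_n)=(6,\,4,\,6,\,2,\,4,\,0,\,2r_7,\dots,2r_n),$$ with $r_j\ge 4$ pairwise distinct integers. Assume that the only non-zero products on $\mathcal{N}$ are given by $$[\mathcal{L}_1,\mathcal{L}_1]=\mathcal{L}_3,\quad[\mathcal{L}_2,\mathcal{L}_5]=\mathcal{L}_6,\quad[\mathcal{L}_1,\mathcal{L}_i]=\mathcal{L}_4,\quad[\mathcal{L}_k,\mathcal{L}_k]=\mathcal{L}_4,$$ where $i\in\{2,3,5\}$ and $k\in\{2,5,7,8,\dots,n\}$. Then the Lie algebra $\mathcal{L}=\mathfrak{sl}_2\ltimes\mathcal{N}$ has the property that all its derivations are inner and its center is non-trivial.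
   Context: All Lie algebras are finite-dimensional over $\mathbb{C}$. $V_\lambda$ denotes the irreducible $\mathfrak{sl}_2$-module of highest weight $\lambda$ (of dimension $\lambda+1$); summands $\mathcal{L}_i$ with equal highest weight are separate isomorphic copies. In $\mathcal{L}=\mathfrak{sl}_2\ltimes\mathcal{N}$, the bracket of $\mathfrak{sl}_2$ with $\mathcal{N}$ is the given module action, so the bracket on $\mathcal{N}$ is $\mathfrak{sl}_2$-equivariant. The notation $[\mathcal{L}_i,\mathcal{L}_j]=\mathcal{L}_k$ means that the brackets of elements of $\mathcal{L}_i$ with elements of $\mathcal{L}_j$ span $\mathcal{L}_k$. Brackets between summands of $\mathcal{N}$ that are not listed (up to antisymmetry) are zero. A derivation is inner if it equals $\operatorname{ad}_x$ for some $x\in\mathcal{L}$.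
   Formalization: Added hypothesis: the centralizer of L_1 in L_2 ⊕ L_5 is not abelian under the bracket of N. Without it the listed products allow an outer derivation (e.g. equal products for L_2 and L_5 except [L_5,L_5] with opposite sign), so the claim fails exactly there. *)

theory Defs
  imports "HOL-Analysis.Analysis"
begin

section \<open>Lie algebras over the complex numbers\<close>

text \<open>The underlying vector space is a whole type; scalar multiplication is a parameter, as in
  \<^locale>\<open>vector_space\<close>.\<close>

locale lie_algebra = vector_space scl
  for scl :: "complex \<Rightarrow> 'a::ab_group_add \<Rightarrow> 'a" +
  fixes br :: "'a \<Rightarrow> 'a \<Rightarrow> 'a"
  assumes finite_dim: "\<exists>B. finite B \<and> span B = UNIV"
    and br_add_left: "br (x + y) z = br x z + br y z"
    and br_add_right: "br x (y + z) = br x y + br x z"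
    and br_scale_left: "br (scl c x) y = scl c (br x y)"
    and br_scale_right: "br x (scl c y) = scl c (br x y)"
    and br_self: "br x x = 0"
    and jacobi: "br x (br y z) + br y (br z x) + br z (br x y) = 0"

definition derivation ::
  "(complex \<Rightarrow> 'a::ab_group_add \<Rightarrow> 'a) \<Rightarrow> ('a \<Rightarrow> 'a \<Rightarrow> 'a) \<Rightarrow> ('a \<Rightarrow> 'a) \<Rightarrow> bool" where
  "derivation scl br D \<longleftrightarrow>
     Vector_Spaces.linear scl scl D \<and> (\<forall>x y. D (br x y) = br (D x) y + br x (D y))"

definition inner_derivation :: "('a \<Rightarrow> 'a \<Rightarrow> 'a) \<Rightarrow> ('a \<Rightarrow> 'a) \<Rightarrow> bool" where
  "inner_derivation br D \<longleftrightarrow> (\<exists>x. \<forall>y. D y = br x y)"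

definition lie_center :: "('a \<Rightarrow> 'a::zero \<Rightarrow> 'a) \<Rightarrow> 'a set" where
  "lie_center br = {z. \<forall>x. br z x = 0}"

definition centralizer :: "('a \<Rightarrow> 'a::zero \<Rightarrow> 'a) \<Rightarrow> 'a set \<Rightarrow> 'a set" where
  "centralizer br A = {z. \<forall>x\<in>A. br x z = 0}"

definition product_span ::
  "(complex \<Rightarrow> 'a::ab_group_add \<Rightarrow> 'a) \<Rightarrow> ('a \<Rightarrow> 'a \<Rightarrow> 'a) \<Rightarrow> 'a set \<Rightarrow> 'a set \<Rightarrow> 'a set" where
  "product_span scl br A B = module.span scl {br x y |x y. x \<in> A \<and> y \<in> B}"

section \<open>Actions by derivations and semidirect products\<close>

locale lie_action_by_derivations =
  S: lie_algebra scaleS brS + N: lie_algebra scaleN brN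
  for scaleS :: "complex \<Rightarrow> 's::ab_group_add \<Rightarrow> 's" and brS
    and scaleN :: "complex \<Rightarrow> 'n::ab_group_add \<Rightarrow> 'n" and brN +
  fixes act :: "'s \<Rightarrow> 'n \<Rightarrow> 'n"
  assumes act_add_left: "act (a + b) x = act a x + act b x"
    and act_add_right: "act a (x + y) = act a x + act a y"
    and act_scale_left: "act (scaleS c a) x = scaleN c (act a x)"
    and act_scale_right: "act a (scaleN c x) = scaleN c (act a x)"
    and act_bracket: "act (brS a b) x = act a (act b x) - act b (act a x)"
    and act_derivation: "act a (brN x y) = brN (act a x) y + brN x (act a y)"

definition semidirect_bracket ::
  "('s \<Rightarrow> 's \<Rightarrow> 's) \<Rightarrow> ('s \<Rightarrow> 'n \<Rightarrow> 'n) \<Rightarrow> ('n \<Rightarrow> 'n \<Rightarrow> 'n) \<Rightarrow>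
   's \<times> 'n \<Rightarrow> 's \<times> 'n \<Rightarrow> 's \<times> 'n::ab_group_add" where
  "semidirect_bracket brS act brN p q =
     (brS (fst p) (fst q), act (fst p) (snd q) - act (fst q) (snd p) + brN (snd p) (snd q))"

abbreviation semidirect_scale ::
  "(complex \<Rightarrow> 's::ab_group_add \<Rightarrow> 's) \<Rightarrow> (complex \<Rightarrow> 'n::ab_group_add \<Rightarrow> 'n) \<Rightarrow>
   complex \<Rightarrow> 's \<times> 'n \<Rightarrow> 's \<times> 'n" where
  "semidirect_scale scaleS scaleN \<equiv> module_prod.scale scaleS scaleN"

lemma (in lie_algebra) br_swap: "br y x = - br x y"
proof -
  have "br (x + y) (x + y) = br x x + br x y + (br y x + br y y)"
    by (simp only: br_add_left br_add_right add_ac)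
  then have "br x y + br y x = 0"
    by (simp add: br_self)
  then show ?thesis by (simp add: eq_neg_iff_add_eq_0 add.commute)
qed

lemma (in lie_algebra) br_diff_left: "br (x - y) z = br x z - br y z"
  using br_add_left[of "x - y" y z] by simp

lemma (in lie_algebra) br_diff_right: "br x (y - z) = br x y - br x z"
  using br_add_right[of x "y - z" z] by simp

lemma (in lie_action_by_derivations) semidirect_lie_algebra:
  "lie_algebra (semidirect_scale scaleS scaleN) (semidirect_bracket brS act brN)"
proof -
  interpret V: vector_space_prod scaleS scaleN by unfold_locales
  have act_diff: "act a (x - y) = act a x - act a y" for a x y
    using act_add_right[of a "x - y" y] by simp
  obtain BS BN where B: "finite BS" "S.span BS = UNIV" "finite BN" "N.span BN = UNIV"
    using S.finite_dim N.finite_dim by blast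
  let ?B = "(\<lambda>a. (a, 0)) ` BS \<union> Pair 0 ` BN"
  have fst_in: "(a, 0) \<in> V.p.span ?B" for a
  proof -
    have "a \<in> S.span BS" using B by simp
    then show ?thesis
    proof (induction rule: S.span_induct_alt)
      case base
      then show ?case using V.p.span_zero[of ?B] by (simp add: zero_prod_def)
    next
      case (step c x y)
      have "V.scale c (x, 0) + (y, 0) \<in> V.p.span ?B"
        by (intro V.p.span_add V.p.span_scale V.p.span_base step) (use step in auto)
      then show ?case by (simp add: V.scale_prod)
    qed
  qed
  have snd_in: "(0, a) \<in> V.p.span ?B" for a
  proof -
    have "a \<in> N.span BN" using B by simp
    then show ?thesis
    proof (induction rule: N.span_induct_alt)
      case base
      then show ?case using V.p.span_zero[of ?B] by (simp add: zero_prod_def)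
    next
      case (step c x y)
      have "V.scale c (0, x) + (0, y) \<in> V.p.span ?B"
        by (intro V.p.span_add V.p.span_scale V.p.span_base step) (use step in auto)
      then show ?case by (simp add: V.scale_prod)
    qed
  qed
  have "p \<in> V.p.span ?B" for p
  proof -
    have "(fst p, 0) + (0, snd p) \<in> V.p.span ?B"
      by (intro V.p.span_add fst_in snd_in)
    then show ?thesis by simp
  qed
  then have span: "V.p.span ?B = UNIV" by blast
  have N_jac: "brN z (brN x y) = - brN x (brN y z) - brN y (brN z x)" for x y z
    using N.jacobi[of x y z] by (simp add: algebra_simps eq_neg_iff_add_eq_0)
  show ?thesis
  proof unfold_locales
    show "\<exists>B. finite B \<and> V.p.span B = UNIV"
      using span B by (intro exI[of _ ?B]) auto
  next
    fix x y z :: "'s \<times> 'n"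
    show "semidirect_bracket brS act brN x (semidirect_bracket brS act brN y z) +
       semidirect_bracket brS act brN y (semidirect_bracket brS act brN z x) +
       semidirect_bracket brS act brN z (semidirect_bracket brS act brN x y) = 0"
    proof (rule prod_eqI)
      show "fst (semidirect_bracket brS act brN x (semidirect_bracket brS act brN y z) +
       semidirect_bracket brS act brN y (semidirect_bracket brS act brN z x) +
       semidirect_bracket brS act brN z (semidirect_bracket brS act brN x y)) = fst 0"
        by (simp add: semidirect_bracket_def S.jacobi)
    next
      obtain a u b v c w where xyz: "x = (a, u)" "y = (b, v)" "z = (c, w)"
        by (metis prod.collapse)
      show "snd (semidirect_bracket brS act brN x (semidirect_bracket brS act brN y z) +
       semidirect_bracket brS act brN y (semidirect_bracket brS act brN z x) +
       semidirect_bracket brS act brN z (semidirect_bracket brS act brN x y)) = snd 0"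
        using N.br_swap[of u "act b w"] N.br_swap[of u "act c v"]
          N.br_swap[of v "act c u"] N.br_swap[of v "act a w"]
          N.br_swap[of w "act a v"] N.br_swap[of w "act b u"]
        by (simp add: xyz semidirect_bracket_def act_add_right act_diff act_bracket act_derivation
            N.br_add_right N.br_diff_right N_jac[of w u v])
    qed
  qed (auto simp: semidirect_bracket_def V.scale_def prod_eq_iff S.br_add_left S.br_add_right
      S.br_scale_left S.br_scale_right S.br_self N.br_add_left N.br_add_right N.br_scale_left
      N.br_scale_right N.br_self act_add_left act_add_right act_scale_left act_scale_right
      N.scale_right_distrib N.scale_right_diff_distrib)
qed

section \<open>The Lie algebra sl2 and its irreducible modules\<close>

typedef sl2 = "{A :: complex^2^2. trace A = 0}"
  by (rule exI[of _ 0]) (simp add: trace_def)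

setup_lifting type_definition_sl2

instantiation sl2 :: ab_group_add
begin

lift_definition zero_sl2 :: sl2 is 0 by (simp add: trace_def)
lift_definition plus_sl2 :: "sl2 \<Rightarrow> sl2 \<Rightarrow> sl2" is "(+)" by (simp add: trace_add)
lift_definition minus_sl2 :: "sl2 \<Rightarrow> sl2 \<Rightarrow> sl2" is "(-)" by (simp add: trace_sub)
lift_definition uminus_sl2 :: "sl2 \<Rightarrow> sl2" is uminus by (simp add: trace_def sum_negf)

instance
  by standard (transfer, simp add: algebra_simps)+

end

lift_definition sl2_scale :: "complex \<Rightarrow> sl2 \<Rightarrow> sl2" is "\<lambda>c A. \<chi> i j. c * A $ i $ j"
proof -
  fix c and A :: "complex^2^2"
  have "trace (\<chi> i j. c * A $ i $ j) = c * trace A"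
    by (simp add: trace_def sum_distrib_left)
  then show "trace A = 0 \<Longrightarrow> trace (\<chi> i j. c * A $ i $ j) = 0" by simp
qed

lift_definition sl2_bracket :: "sl2 \<Rightarrow> sl2 \<Rightarrow> sl2" is "\<lambda>A B. A ** B - B ** A"
  by (subst trace_sub, subst trace_mul_sym) simp

lift_definition sl2_e :: sl2 is "vector [vector [0, 1], vector [0, 0]]"
  by (simp add: trace_def sum_2)

lift_definition sl2_f :: sl2 is "vector [vector [0, 0], vector [1, 0]]"
  by (simp add: trace_def sum_2)

lift_definition sl2_h :: sl2 is "vector [vector [1, 0], vector [0, -1]]"
  by (simp add: trace_def sum_2)

lemma sl2_relations:
  "sl2_bracket sl2_h sl2_e = sl2_scale 2 sl2_e"
  "sl2_bracket sl2_h sl2_f = sl2_scale (-2) sl2_f"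
  "sl2_bracket sl2_e sl2_f = sl2_h"
  by (transfer, simp add: vec_eq_iff forall_2 matrix_matrix_mult_def sum_2)+

interpretation sl2: vector_space sl2_scale
  by unfold_locales (transfer, simp add: vec_eq_iff algebra_simps)+

lemma sl2_expand: "\<exists>a b c. x = sl2_scale a sl2_e + sl2_scale b sl2_h + sl2_scale c sl2_f"
proof transfer
  fix x :: "complex^2^2"
  assume "trace x = 0"
  then have "x $ 2 $ 2 = - x $ 1 $ 1"
    by (simp add: trace_def sum_2 eq_neg_iff_add_eq_0 add.commute)
  then show "\<exists>a b c. x = (\<chi> i j. a * vector [vector [0, 1], vector [0, 0]] $ i $ j) +
      (\<chi> i j. b * vector [vector [1, 0], vector [0, - 1]] $ i $ j) +
      (\<chi> i j. c * vector [vector [0, 0], vector [1, 0]] $ i $ j)"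
    by (intro exI[of _ "x $ 1 $ 2"] exI[of _ "x $ 1 $ 1"] exI[of _ "x $ 2 $ 1"])
      (simp add: vec_eq_iff forall_2)
qed

interpretation sl2: lie_algebra sl2_scale sl2_bracket
proof unfold_locales
  have "x \<in> sl2.span {sl2_e, sl2_h, sl2_f}" for x
    using sl2_expand[of x] by (auto intro!: sl2.span_add sl2.span_scale intro: sl2.span_base)
  then show "\<exists>B. finite B \<and> sl2.span B = UNIV"
    by (intro exI[of _ "{sl2_e, sl2_h, sl2_f}"]) auto
next
  fix x y z :: sl2 and c :: complex
  show "sl2_bracket (x + y) z = sl2_bracket x z + sl2_bracket y z"
    by transfer (simp add: vec_eq_iff matrix_matrix_mult_def sum.distrib algebra_simps)
  show "sl2_bracket x (y + z) = sl2_bracket x y + sl2_bracket x z"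
    by transfer (simp add: vec_eq_iff matrix_matrix_mult_def sum.distrib algebra_simps)
  show "sl2_bracket (sl2_scale c x) y = sl2_scale c (sl2_bracket x y)"
    by transfer (simp add: vec_eq_iff matrix_matrix_mult_def sum_distrib_left algebra_simps)
  show "sl2_bracket x (sl2_scale c y) = sl2_scale c (sl2_bracket x y)"
    by transfer (simp add: vec_eq_iff matrix_matrix_mult_def sum_distrib_left algebra_simps)
  show "sl2_bracket x x = 0"
    by transfer simp
  have diff: "A ** (B - C) = A ** B - A ** C" "(B - C) ** A = B ** A - C ** A"
    for A B C :: "complex^2^2"
    by (simp_all add: vec_eq_iff matrix_matrix_mult_def sum_subtractf algebra_simps)
  show "sl2_bracket x (sl2_bracket y z) + sl2_bracket y (sl2_bracket z x)
      + sl2_bracket z (sl2_bracket x y) = 0"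
    by transfer (simp add: diff matrix_mul_assoc)
qed

definition sl2_submodule ::
  "(complex \<Rightarrow> 'n::ab_group_add \<Rightarrow> 'n) \<Rightarrow> (sl2 \<Rightarrow> 'n \<Rightarrow> 'n) \<Rightarrow> 'n set \<Rightarrow> bool" where
  "sl2_submodule scl act W \<longleftrightarrow>
     module.subspace scl W \<and> (\<forall>a. \<forall>x\<in>W. act a x \<in> W)"

definition irreducible_sl2_submodule ::
  "(complex \<Rightarrow> 'n::ab_group_add \<Rightarrow> 'n) \<Rightarrow> (sl2 \<Rightarrow> 'n \<Rightarrow> 'n) \<Rightarrow> 'n set \<Rightarrow> bool" where
  "irreducible_sl2_submodule scl act W \<longleftrightarrow>
     sl2_submodule scl act W \<and> W \<noteq> {0} \<and>
     (\<forall>U. sl2_submodule scl act U \<and> U \<subseteq> W \<longrightarrow> U = {0} \<or> U = W)"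

definition irreducible_of_highest_weight ::
  "(complex \<Rightarrow> 'n::ab_group_add \<Rightarrow> 'n) \<Rightarrow> (sl2 \<Rightarrow> 'n \<Rightarrow> 'n) \<Rightarrow> nat \<Rightarrow> 'n set \<Rightarrow> bool" where
  "irreducible_of_highest_weight scl act l W \<longleftrightarrow>
     irreducible_sl2_submodule scl act W \<and>
     (\<exists>v\<in>W. v \<noteq> 0 \<and> act sl2_e v = 0 \<and> act sl2_h v = scl (of_nat l) v)"

definition internal_direct_sum :: "nat \<Rightarrow> (nat \<Rightarrow> 'n::ab_group_add set) \<Rightarrow> bool" where
  "internal_direct_sum n L \<longleftrightarrow>
     (\<forall>x. \<exists>!f. f \<in> (\<Pi>\<^sub>E i\<in>{1..n}. L i) \<and> x = (\<Sum>i\<in>{1..n}. f i))"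

section \<open>The data of the theorem\<close>

definition highest_weights :: "(nat \<Rightarrow> nat) \<Rightarrow> nat \<Rightarrow> nat" where
  "highest_weights r i =
     (if i = 1 then 6 else if i = 2 then 4 else if i = 3 then 6 else
      if i = 4 then 2 else if i = 5 then 4 else if i = 6 then 0 else 2 * r i)"

definition nonzero_products :: "nat \<Rightarrow> (nat \<times> nat) set" where
  "nonzero_products n =
     {(1, 1), (2, 5)} \<union> {1} \<times> {2, 3, 5} \<union> {(k, k) |k. k \<in> {2, 5} \<union> {7..n}}"

definition prescribed_products ::
  "(complex \<Rightarrow> 'n::ab_group_add \<Rightarrow> 'n) \<Rightarrow> ('n \<Rightarrow> 'n \<Rightarrow> 'n) \<Rightarrow> nat \<Rightarrow> (nat \<Rightarrow> 'n set) \<Rightarrow> bool" where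
  "prescribed_products scl br n L \<longleftrightarrow>
     product_span scl br (L 1) (L 1) = L 3 \<and>
     product_span scl br (L 2) (L 5) = L 6 \<and>
     (\<forall>i\<in>{2, 3, 5}. product_span scl br (L 1) (L i) = L 4) \<and>
     (\<forall>k\<in>{2, 5} \<union> {7..n}. product_span scl br (L k) (L k) = L 4) \<and>
     (\<forall>i\<in>{1..n}. \<forall>j\<in>{1..n}.
        (i, j) \<notin> nonzero_products n \<and> (j, i) \<notin> nonzero_products n \<longrightarrow>
        (\<forall>x\<in>L i. \<forall>y\<in>L j. br x y = 0))"

text \<open>The prescribed products determine the bracket only up to one non-zero scalar for each listed
  pair of summands. Identify \<open>L 2\<close> and \<open>L 5\<close> with one copy of the module of highest weight 4, fix
  non-zero equivariant maps \<open>\<eta>\<close> (weights 6 and 4 to 2) and \<open>\<theta>\<close> (weights 4 and 4 to 2), and write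
  the products of \<open>L 1\<close> with \<open>L 2\<close> and \<open>L 5\<close> as \<open>s \<eta>\<close> and \<open>t \<eta>\<close>, those of \<open>L 2\<close> and of \<open>L 5\<close>
  with themselves as \<open>p \<theta>\<close> and \<open>q \<theta>\<close>. The ratio of \<open>s^2 q\<close> and \<open>t^2 p\<close> does not change under
  rescaling of the summands. If \<open>s^2 q + t^2 p = 0\<close>, then there is an outer derivation: it kills sl2,
  acts as 1, 2, 3, 3, 3/2 on \<open>L 1\<close>, \<open>L 3\<close>, \<open>L 4\<close>, \<open>L 6\<close>, \<open>L j\<close> (\<open>j \<ge> 7\<close>), and sends \<open>y\<close> in
  \<open>L 2\<close> to \<open>(3/2) y + (s/(2t)) y'\<close> and \<open>y'\<close> in \<open>L 5\<close> to \<open>(3/2) y' + (t/(2s)) y\<close>, where \<open>y'\<close> is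
  the copy of \<open>y\<close>. So this one degenerate case has to be excluded. The centralizer of \<open>L 1\<close> in
  \<open>L 2 \<oplus> L 5\<close> consists of the vectors \<open>t y - s y'\<close>, and the product of two of them is
  \<open>(s^2 q + t^2 p) \<theta>\<close>; hence the case is excluded by requiring that the centralizer is not abelian.
  This holds for instance if the same maps are chosen for both copies (\<open>s = t\<close>, \<open>p = q\<close>).\<close>

definition nondegenerate_products :: "('n \<Rightarrow> 'n \<Rightarrow> 'n) \<Rightarrow> (nat \<Rightarrow> 'n::ab_group_add set) \<Rightarrow> bool" where
  "nondegenerate_products br L \<longleftrightarrow>
     (let C = centralizer br (L 1) \<inter> {y + z |y z. y \<in> L 2 \<and> z \<in> L 5}
      in \<exists>u\<in>C. \<exists>v\<in>C. br u v \<noteq> 0)"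

end

theory Submission
  imports Defs
begin

text \<open>By Whitehead's first lemma, proved with the Casimir element, a derivation may be changed by an inner
  one so that it vanishes on sl2. It is then equivariant, hence by Schur's lemma determined by its
  scalars on the summands and its mixing of \<open>L 1\<close> with \<open>L 3\<close> and of \<open>L 2\<close> with \<open>L 5\<close>. The
  component from \<open>L 1\<close> to \<open>L 3\<close> vanishes because a symmetric equivariant product of modules of
  highest weight 6 cannot reach highest weight 2. If \<open>a\<close> is the scalar on \<open>L 1\<close>, then the products force
  \<open>2a\<close> on \<open>L 3\<close>, \<open>3a\<close> on \<open>L 4\<close> and \<open>L 6\<close>, and \<open>3a/2\<close> on \<open>L k\<close> for \<open>k \<ge> 7\<close> and on the diagonal of
  \<open>L 2 \<oplus> L 5\<close>. For \<open>a \<noteq> 0\<close> the derivation acts by \<open>a\<close> on the centralizer of \<open>L 1\<close> in \<open>L 2 \<oplus> L 5\<close>,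
  so it acts by \<open>2a \<noteq> 3a\<close> on products of that centralizer, which lie in \<open>L 4 \<oplus> L 6\<close>; these products are
  therefore zero, against nondegeneracy. The center contains \<open>L 6\<close>.\<close>

section \<open>Modules over sl2\<close>

lemma (in lie_algebra) br_minus_right: "br x (- y) = - br x y"
  using br_diff_right[of x 0 y] br_diff_right[of x 0 0] by simp

lemma (in lie_algebra) br_minus_left: "br (- x) y = - br x y"
  using br_diff_left[of 0 x y] br_diff_left[of 0 0 y] by simp

text \<open>The Jacobi identity as the statement that the adjoint map is a representation; read the
  other way, each \<open>br x\<close> satisfies the Leibniz rule.\<close>

lemma (in lie_algebra) br_br_left: "br (br x y) z = br x (br y z) - br y (br x z)"
proof -
  have "br z (br x y) = - br (br x y) z" by (rule br_swap)
  moreover have "br y (br z x) = - br y (br x z)"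
    by (subst br_swap) (rule br_minus_right)
  ultimately show ?thesis using jacobi[of x y z] by (simp add: algebra_simps)
qed

section \<open>Commutation relations and the Casimir element\<close>

locale sl2_module = vector_space scl
  for scl :: "complex \<Rightarrow> 'v::ab_group_add \<Rightarrow> 'v" +
  fixes act :: "sl2 \<Rightarrow> 'v \<Rightarrow> 'v"
  assumes act_add_left: "act (a + b) x = act a x + act b x"
    and act_add_right: "act a (x + y) = act a x + act a y"
    and act_scale_left: "act (sl2_scale c a) x = scl c (act a x)"
    and act_scale_right: "act a (scl c x) = scl c (act a x)"
    and act_bracket: "act (sl2_bracket a b) x = act a (act b x) - act b (act a x)"
begin

abbreviation "E \<equiv> act sl2_e"
abbreviation "F \<equiv> act sl2_f"
abbreviation "H \<equiv> act sl2_h"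

lemma act_zero [simp]: "act a 0 = 0"
  using act_add_right[of a 0 0] by simp

lemma act_minus: "act a (- x) = - act a x"
  using act_add_right[of a x "- x"] by (simp add: eq_neg_iff_add_eq_0 add.commute)

lemma act_diff: "act a (x - y) = act a x - act a y"
  using act_add_right[of a x "- y"] by (simp add: act_minus)

lemma act_sum: "act a (sum g I) = (\<Sum>i\<in>I. act a (g i))"
  by (induction I rule: infinite_finite_induct) (auto simp: act_add_right)

lemma scl_two: "scl 2 x = x + x"
  using scale_left_distrib[of 1 1 x] by simp

lemma scl_four: "scl 4 x = x + x + (x + x)"
  using scale_left_distrib[of 2 2 x] by (simp add: scl_two)

lemma EF: "E (F x) = F (E x) + H x"
  using act_bracket[of sl2_e sl2_f x] by (simp add: sl2_relations)

lemma EH: "E (H x) = H (E x) - E x - E x"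
  using act_bracket[of sl2_h sl2_e x] by (simp add: sl2_relations act_scale_left scl_two algebra_simps)

lemma HF: "H (F x) = F (H x) - F x - F x"
  using act_bracket[of sl2_h sl2_f x]
  by (simp add: sl2_relations act_scale_left scl_two algebra_simps del: sl2.scale_minus_left)

text \<open>These rules rewrite words to Poincare-Birkhoff-Witt order, \<open>F\<close> outermost
  and \<open>E\<close> innermost. With multiples expanded by \<open>scl_two\<close> and
  \<open>scl_four\<close>, identities of the enveloping algebra become identities of an abelian
  group.\<close>

lemmas normal_order = EF EH HF act_add_right act_diff act_minus

text \<open>The Casimir element 2(EF + FE) + H^2 in normal order, scaled so that it acts by l(l + 2)
  on highest weight l.\<close>

definition casimir :: "'v \<Rightarrow> 'v" where
  "casimir x = scl 4 (F (E x)) + scl 2 (H x) + H (H x)"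

lemma act_expand:
  obtains \<alpha> \<beta> \<gamma> where "\<And>x. act a x = scl \<alpha> (E x) + scl \<beta> (H x) + scl \<gamma> (F x)"
  using sl2_expand[of a] by (auto simp: act_add_left act_scale_left)

lemma casimir_add: "casimir (x + y) = casimir x + casimir y"
  by (simp add: casimir_def act_add_right scale_right_distrib algebra_simps)

lemma casimir_scale: "casimir (scl c x) = scl c (casimir x)"
  by (simp add: casimir_def act_scale_right scale_right_distrib mult.commute)

lemma casimir_act: "casimir (act a x) = act a (casimir x)"
proof -
  have *: "casimir (E x) = E (casimir x)" "casimir (H x) = H (casimir x)"
    "casimir (F x) = F (casimir x)"
    by (simp_all add: casimir_def scl_two scl_four normal_order algebra_simps)
  show ?thesis
    by (rule act_expand[of a]) (simp add: casimir_add casimir_scale *)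
qed

text \<open>The Casimir element acts as multiplication by \<open>c\<close> on the values of the cocycle, so pairing the
  cocycle with the dual basis used in the Casimir element gives \<open>c\<close> times a primitive.\<close>

lemma cocycle_is_coboundary:
  assumes add: "\<And>a b. \<phi> (a + b) = \<phi> a + \<phi> b"
    and scale: "\<And>c a. \<phi> (sl2_scale c a) = scl c (\<phi> a)"
    and cocycle: "\<And>a b. \<phi> (sl2_bracket a b) = act a (\<phi> b) - act b (\<phi> a)"
    and casimir: "\<And>a. casimir (\<phi> a) = scl c (\<phi> a)" and "c \<noteq> 0"
  shows "\<exists>x. \<forall>a. \<phi> a = act a x"
proof -
  define x where "x = scl 2 (E (\<phi> sl2_f)) + scl 2 (F (\<phi> sl2_e)) + H (\<phi> sl2_h)"
  have c1: "E (\<phi> sl2_f) = F (\<phi> sl2_e) + \<phi> sl2_h"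
    using cocycle[of sl2_e sl2_f] by (simp add: sl2_relations)
  have c2: "E (\<phi> sl2_h) = H (\<phi> sl2_e) - \<phi> sl2_e - \<phi> sl2_e"
    using cocycle[of sl2_h sl2_e] by (simp add: sl2_relations scale scl_two algebra_simps)
  have c3: "H (\<phi> sl2_f) = F (\<phi> sl2_h) - \<phi> sl2_f - \<phi> sl2_f"
    using cocycle[of sl2_h sl2_f]
    by (simp add: sl2_relations scale scl_two algebra_simps del: sl2.scale_minus_left)
  \<comment> \<open>By the cocycle relations \<open>c1\<close> to \<open>c3\<close>,
    \<open>x\<close> is a primitive of the cocycle composed with the Casimir element.\<close>
  have *: "E x = casimir (\<phi> sl2_e)" "H x = casimir (\<phi> sl2_h)" "F x = casimir (\<phi> sl2_f)"
    by (simp_all add: x_def casimir_def scl_two scl_four c1 c2 c3 normal_order algebra_simps)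
  have "\<phi> a = act a (scl (1 / c) x)" for a
  proof -
    obtain \<alpha> \<beta> \<gamma> where a: "a = sl2_scale \<alpha> sl2_e + sl2_scale \<beta> sl2_h + sl2_scale \<gamma> sl2_f"
      using sl2_expand by blast
    show ?thesis
      using \<open>c \<noteq> 0\<close> by (simp add: a add scale act_add_left act_scale_left act_scale_right scale_right_distrib
          * casimir)
  qed
  then show ?thesis by blast
qed

lemma sl2_submoduleI:
  assumes "subspace W" and "\<And>x. x \<in> W \<Longrightarrow> E x \<in> W" "\<And>x. x \<in> W \<Longrightarrow> H x \<in> W" "\<And>x. x \<in> W \<Longrightarrow> F x \<in> W"
  shows "sl2_submodule scl act W"
  unfolding sl2_submodule_def
proof (intro conjI allI ballI assms(1))
  fix a x assume "x \<in> W"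
  show "act a x \<in> W"
    by (rule act_expand[of a]) (simp add: \<open>x \<in> W\<close> assms subspace_add subspace_scale)
qed

section \<open>Primitive vectors and powers of \<open>F\<close>\<close>

lemma H_F_power:
  assumes "E v = 0" "H v = scl \<mu> v"
  shows "H ((F ^^ k) v) = scl (\<mu> - 2 * of_nat k) ((F ^^ k) v)"
proof (induction k)
  case (Suc k)
  have "H ((F ^^ Suc k) v) = scl (\<mu> - 2 * of_nat k) ((F ^^ Suc k) v) - scl 2 ((F ^^ Suc k) v)"
    by (simp add: HF Suc act_scale_right scl_two)
  then show ?case by (simp only: scale_left_diff_distrib[symmetric]) (simp add: algebra_simps)
qed (use assms in simp)

text \<open>Moving \<open>E\<close> past one \<open>F\<close> adds the weight of the vector; the sum
  of \<mu> - 2j over j \<le> k is (k + 1)(\<mu> - k).\<close>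

lemma E_F_power:
  assumes "E v = 0" "H v = scl \<mu> v"
  shows "E ((F ^^ Suc k) v) = scl (of_nat (Suc k) * (\<mu> - of_nat k)) ((F ^^ k) v)"
proof (induction k)
  case (Suc k)
  have "E ((F ^^ Suc (Suc k)) v) = F (E ((F ^^ Suc k) v)) + H ((F ^^ Suc k) v)"
    by (simp add: EF)
  also have "\<dots> = scl (of_nat (Suc k) * (\<mu> - of_nat k) + (\<mu> - 2 * of_nat (Suc k))) ((F ^^ Suc k) v)"
    unfolding Suc H_F_power[OF assms] by (simp add: act_scale_right scale_left_distrib)
  finally show ?case by (simp add: algebra_simps)
qed (use assms in \<open>simp add: EF\<close>)

lemma casimir_primitive:
  assumes "E v = 0" "H v = scl \<mu> v"
  shows "casimir v = scl (\<mu> * (\<mu> + 2)) v"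
proof -
  have "casimir v = scl (2 * \<mu>) v + scl (\<mu> * \<mu>) v"
    by (simp add: casimir_def assms act_scale_right)
  then show ?thesis by (simp only: scale_left_distrib[symmetric]) (simp add: algebra_simps)
qed

text \<open>Induction on the index set: \<open>H\<close> minus \<open>\<mu> j\<close> kills the
  summand \<open>x j\<close> and multiplies every other one by a non-zero number. A family, unlike a
  set of vectors, may contain zeros.\<close>

lemma eigenvectors_sum_zero:
  assumes "finite I" "inj_on \<mu> I" "\<And>i. i \<in> I \<Longrightarrow> H (x i) = scl (\<mu> i) (x i)" "sum x I = 0" "i \<in> I"
  shows "x i = 0"
  using assms
proof (induction I arbitrary: x i rule: finite_induct)
  case (insert j I)
  have "0 = H (sum x (insert j I)) - scl (\<mu> j) (sum x (insert j I))"
    using insert.prems by simp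
  also have "\<dots> = (\<Sum>i\<in>insert j I. H (x i) - scl (\<mu> j) (x i))"
    by (simp only: act_sum scale_sum_right sum_subtractf)
  also have "\<dots> = (\<Sum>i\<in>insert j I. scl (\<mu> i - \<mu> j) (x i))"
    by (rule sum.cong) (auto simp: insert.prems(2) scale_left_diff_distrib)
  also have "\<dots> = (\<Sum>i\<in>I. scl (\<mu> i - \<mu> j) (x i))"
    using insert.hyps by simp
  finally have 0: "(\<Sum>i\<in>I. scl (\<mu> i - \<mu> j) (x i)) = 0" by simp
  have I: "x i = 0" if "i \<in> I" for i
  proof -
    have "scl (\<mu> i - \<mu> j) (x i) = 0"
      using insert.IH[of "\<lambda>i. scl (\<mu> i - \<mu> j) (x i)", OF _ _ 0 that] insert.prems(1,2)
      by (auto simp: act_scale_right mult.commute)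
    moreover have "\<mu> i \<noteq> \<mu> j"
      using insert.prems(1) insert.hyps that by (auto simp: inj_on_def)
    ultimately show ?thesis by simp
  qed
  then have "sum x I = 0" by simp
  then show ?case
    using I insert.prems(3,4) insert.hyps by auto
qed simp


text \<open>Otherwise the vectors \<open>F^k v\<close> are non-zero for all \<open>k\<close>, so they are infinitely many
  independent eigenvectors of \<open>H\<close>.\<close>

lemma primitive_weight_nat:
  assumes fin: "finite B" "span B = UNIV" and v: "E v = 0" "H v = scl \<mu> v" "v \<noteq> 0"
  shows "\<exists>m. \<mu> = of_nat m"
proof -
  let ?g = "\<lambda>k. (F ^^ k) v"
  have "\<exists>k. ?g k = 0"
  proof (rule ccontr)
    assume "\<nexists>k. ?g k = 0"
    then have nz: "?g k \<noteq> 0" for k by blast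
    have inj: "inj ?g"
    proof (rule injI)
      fix k l assume eq: "?g k = ?g l"
      have "scl (\<mu> - 2 * of_nat k) (?g k) = scl (\<mu> - 2 * of_nat l) (?g k)"
        using H_F_power[OF v(1,2)] eq by metis
      then show "k = l" using nz[of k] by (auto dest: scale_right_imp_eq[rotated])
    qed
    have "independent (range ?g)"
    proof
      assume "dependent (range ?g)"
      then obtain t u a where t: "finite t" "t \<subseteq> range ?g" "(\<Sum>w\<in>t. scl (u w) w) = 0" "a \<in> t" "u a \<noteq> 0"
        unfolding dependent_explicit by blast
      obtain K where K: "t = ?g ` K" by (rule subset_imageE[OF t(2)])
      have inj': "inj_on ?g K" using inj by (rule inj_on_subset) simp
      have fK: "finite K" using t(1) inj' by (simp add: K finite_image_iff)
      obtain k where k: "k \<in> K" "a = ?g k" using t(4) K by blast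
      have "scl (u (?g k)) (?g k) = 0"
      proof (rule eigenvectors_sum_zero[of K "\<lambda>k. \<mu> - 2 * of_nat k" "\<lambda>k. scl (u (?g k)) (?g k)"])
        show "inj_on (\<lambda>k. \<mu> - 2 * of_nat k) K" by (auto simp: inj_on_def)
        show "(\<Sum>k\<in>K. scl (u (?g k)) (?g k)) = 0"
          using t(3) by (simp add: K sum.reindex[OF inj'])
        show "H (scl (u (?g k)) (?g k)) = scl (\<mu> - 2 * of_nat k) (scl (u (?g k)) (?g k))" for k
          by (simp add: act_scale_right H_F_power[OF v(1,2)] mult.commute)
      qed (use fK k in auto)
      then show False using nz[of k] t(5) k by simp
    qed
    then have "finite (range ?g)"
      using independent_span_bound[OF fin(1)] fin(2) by blast
    then show False using inj by (simp add: finite_image_iff)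
  qed
  then obtain k where k: "?g k = 0" "\<And>j. j < k \<Longrightarrow> ?g j \<noteq> 0"
    using exists_least_iff[of "\<lambda>k. ?g k = 0"] by blast
  then obtain m where m: "k = Suc m" using v(3) by (cases k) auto
  \<comment> \<open>\<open>F^(m+1) v\<close> is the first power to vanish, so its image under
    \<open>E\<close> forces (m + 1)(\<mu> - m) = 0.\<close>
  have "scl (of_nat (Suc m) * (\<mu> - of_nat m)) (?g m) = 0"
    using E_F_power[OF v(1,2), of m] k(1) by (simp only: m act_zero)
  then show ?thesis
    using k(2)[of m] m by (auto simp: simp del: of_nat_Suc)
qed

section \<open>Equivariant maps and Schur's lemma\<close>

definition equivariant :: "('v \<Rightarrow> 'v) \<Rightarrow> bool" where
  "equivariant S \<longleftrightarrow> (\<forall>x y. S (x + y) = S x + S y) \<and> (\<forall>c x. S (scl c x) = scl c (S x)) \<and>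
     (\<forall>a x. S (act a x) = act a (S x))"

lemma equivariantD:
  assumes "equivariant S"
  shows "S (x + y) = S x + S y" "S (scl c x) = scl c (S x)" "S (act a x) = act a (S x)" "S 0 = 0"
proof -
  show "S (x + y) = S x + S y" "S (scl c x) = scl c (S x)" "S (act a x) = act a (S x)"
    using assms unfolding equivariant_def by blast+
  show "S 0 = 0"
    using assms unfolding equivariant_def by (metis scale_zero_left)
qed

lemma equivariant_comp: "equivariant S \<Longrightarrow> equivariant T \<Longrightarrow> equivariant (\<lambda>x. S (T x))"
  by (simp add: equivariant_def)

lemma equivariant_casimir: "equivariant S \<Longrightarrow> S (casimir x) = casimir (S x)"
  by (simp add: casimir_def equivariantD)

abbreviation "irrep \<equiv> irreducible_of_highest_weight scl act"

lemma submoduleD: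
  assumes "sl2_submodule scl act W"
  shows "subspace W" "x \<in> W \<Longrightarrow> act a x \<in> W"
    "0 \<in> W" "x \<in> W \<Longrightarrow> scl c x \<in> W" "x \<in> W \<Longrightarrow> y \<in> W \<Longrightarrow> x + y \<in> W"
    "x \<in> W \<Longrightarrow> y \<in> W \<Longrightarrow> x - y \<in> W" "x \<in> W \<Longrightarrow> - x \<in> W"
proof -
  show s: "subspace W"
    using assms by (simp add: sl2_submodule_def)
  show "x \<in> W \<Longrightarrow> act a x \<in> W"
    using assms by (simp add: sl2_submodule_def)
  show "0 \<in> W" "x \<in> W \<Longrightarrow> scl c x \<in> W" "x \<in> W \<Longrightarrow> y \<in> W \<Longrightarrow> x + y \<in> W"
    "x \<in> W \<Longrightarrow> y \<in> W \<Longrightarrow> x - y \<in> W" "x \<in> W \<Longrightarrow> - x \<in> W"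
    by (simp_all add: s subspace_0 subspace_scale subspace_add subspace_diff subspace_neg)
qed

lemma irrep_submodule: "irrep l W \<Longrightarrow> sl2_submodule scl act W"
  by (simp add: irreducible_of_highest_weight_def irreducible_sl2_submodule_def)

lemma irrep_cases:
  assumes "irrep l W" "sl2_submodule scl act U" "U \<subseteq> W" "x \<in> U" "x \<noteq> 0"
  shows "U = W"
proof -
  have "U = {0} \<or> U = W"
    using assms(1-3) unfolding irreducible_of_highest_weight_def irreducible_sl2_submodule_def by iprover
  then show ?thesis using assms(4,5) by auto
qed

lemma irrep_nonzero: "irrep l W \<Longrightarrow> \<exists>x\<in>W. x \<noteq> 0"
  unfolding irreducible_of_highest_weight_def by fast

text \<open>Induction principle for irreducible modules: the vectors with \<open>P\<close> form a
  submodule, non-zero because it contains \<open>v\<close>.\<close>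

lemma irrep_invariant_predicate:
  assumes W: "irrep l W"
    and P: "\<And>x y. x \<in> W \<Longrightarrow> y \<in> W \<Longrightarrow> P x \<Longrightarrow> P y \<Longrightarrow> P (x + y)"
      "\<And>c x. x \<in> W \<Longrightarrow> P x \<Longrightarrow> P (scl c x)" "\<And>a x. x \<in> W \<Longrightarrow> P x \<Longrightarrow> P (act a x)"
    and "v \<in> W" "P v" "v \<noteq> 0" "x \<in> W"
  shows "P x"
proof -
  note sm = submoduleD[OF irrep_submodule[OF W]]
  have "P (scl 0 v)" using P(2) assms(5,6) by blast
  then have "subspace {x \<in> W. P x}"
    by (intro subspaceI) (auto intro: P sm)
  then have "sl2_submodule scl act {x \<in> W. P x}"
    unfolding sl2_submodule_def by (auto intro: P sm)
  then have "{x \<in> W. P x} = W"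
    by (rule irrep_cases[OF W, where x = v]) (use assms in auto)
  then show ?thesis using assms by blast
qed

text \<open>A highest weight vector lies in this eigenspace, and the eigenspace is a submodule
  because the Casimir element is central.\<close>

lemma casimir_irrep:
  assumes W: "irrep l W" and "x \<in> W"
  shows "casimir x = scl (of_nat (l * (l + 2))) x"
proof -
  obtain v where v: "v \<in> W" "v \<noteq> 0" "E v = 0" "H v = scl (of_nat l) v"
    using W by (auto simp: irreducible_of_highest_weight_def)
  show ?thesis
  proof (rule irrep_invariant_predicate[OF W _ _ _ v(1) _ v(2) \<open>x \<in> W\<close>])
    show "casimir v = scl (of_nat (l * (l + 2))) v"
      using casimir_primitive[OF v(3,4)] by (simp only: of_nat_mult of_nat_add of_nat_numeral)
  next
    fix x y assume "casimir x = scl (of_nat (l * (l + 2))) x" "casimir y = scl (of_nat (l * (l + 2))) y"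
    then show "casimir (x + y) = scl (of_nat (l * (l + 2))) (x + y)"
      by (simp only: casimir_add scale_right_distrib)
  next
    fix c x assume "casimir x = scl (of_nat (l * (l + 2))) x"
    then show "casimir (scl c x) = scl (of_nat (l * (l + 2))) (scl c x)"
      by (simp only: casimir_scale scale_scale mult.commute)
  next
    fix a x assume "casimir x = scl (of_nat (l * (l + 2))) x"
    then show "casimir (act a x) = scl (of_nat (l * (l + 2))) (act a x)"
      by (simp only: casimir_act act_scale_right)
  qed
qed

text \<open>Strict monotonicity of l(l + 2) lets the Casimir eigenvalue recognize the highest
  weight.\<close>

lemma weight_eq_iff: "(l::nat) * (l + 2) = m * (m + 2) \<longleftrightarrow> l = m"
proof -
  have "l * (l + 2) < m * (m + 2)" if "l < m" for l m :: nat
    by (rule mult_strict_mono) (use that in auto)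
  from this[of l m] this[of m l] show ?thesis by (cases l m rule: linorder_cases) auto
qed

lemma casimir_eigenvalue_unique:
  assumes "irrep l W" "x \<in> W" "x \<noteq> 0" "casimir x = scl (of_nat (m * (m + 2))) x"
  shows "m = l"
proof -
  have "(of_nat (m * (m + 2)) :: complex) = of_nat (l * (l + 2))"
    using casimir_irrep[OF assms(1,2)] assms(3,4) by (metis scale_right_imp_eq)
  then have "m * (m + 2) = l * (l + 2)" by (simp only: of_nat_eq_iff)
  then show ?thesis by (simp only: weight_eq_iff)
qed

text \<open>Schur's lemma for different weights: \<open>S\<close> preserves Casimir eigenvalues, and
  those of \<open>W\<close> and \<open>W'\<close> differ.\<close>

lemma equivariant_zero:
  assumes "equivariant S" "irrep l W" "irrep m W'" "l \<noteq> m" "x \<in> W" "S x \<in> W'"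
  shows "S x = 0"
proof (rule ccontr)
  assume "S x \<noteq> 0"
  moreover have "casimir (S x) = scl (of_nat (l * (l + 2))) (S x)"
    using equivariant_casimir[OF assms(1), of x]
    by (simp only: casimir_irrep[OF assms(2,5)] equivariantD(2)[OF assms(1)])
  ultimately show False
    using casimir_eigenvalue_unique[OF assms(3,6)] assms(4) by blast
qed

lemma funpow_F_mem: "sl2_submodule scl act W \<Longrightarrow> v \<in> W \<Longrightarrow> (F ^^ k) v \<in> W"
  by (induction k) (auto intro: submoduleD)

text \<open>By the formulas for \<open>E\<close> and \<open>H\<close> on powers of \<open>F\<close>,
  the span is a submodule; it contains \<open>v\<close>, so irreducibility makes it all of
  \<open>W\<close>.\<close>

lemma irrep_eq_span:
  assumes W: "irrep l W" and v: "v \<in> W" "v \<noteq> 0" "E v = 0" "H v = scl \<mu> v"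
  shows "W = span (range (\<lambda>k. (F ^^ k) v))" (is "W = span ?R")
proof -
  note sm = irrep_submodule[OF W]
  have g: "(F ^^ k) v \<in> span ?R" for k
    by (rule span_base) simp
  have gE: "E ((F ^^ k) v) \<in> span ?R" for k
  proof (cases k)
    case 0
    then show ?thesis using v(3) by (simp add: span_zero)
  next
    case (Suc m)
    then show ?thesis
      using E_F_power[OF v(3,4), of m] span_scale[OF g[of m]] by (simp only:)
  qed
  have gH: "H ((F ^^ k) v) \<in> span ?R" for k
    using H_F_power[OF v(3,4), of k] span_scale[OF g[of k]] by (simp only:)
  have gF: "F ((F ^^ k) v) \<in> span ?R" for k
    using g[of "Suc k"] by simp
  have ind: "act a x \<in> span ?R" if "x \<in> span ?R" and G: "\<And>k. act a ((F ^^ k) v) \<in> span ?R" for a x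
    using that(1)
  proof (induction rule: span_induct_alt)
    case base
    then show ?case by (simp add: span_zero)
  next
    case (step c x y)
    have "act a x \<in> span ?R" using step(1) G by auto
    then show ?case
      unfolding act_add_right act_scale_right by (intro span_add span_scale step)
  qed
  have "sl2_submodule scl act (span ?R)"
    by (rule sl2_submoduleI[OF subspace_span]) (rule ind, assumption, rule gE gH gF)+
  moreover have "span ?R \<subseteq> W"
    by (rule span_minimal) (auto intro: funpow_F_mem[OF sm v(1)] submoduleD(1)[OF sm])
  ultimately show ?thesis
    using irrep_cases[OF W, of "span ?R" v] g[of 0] v(2) by simp
qed

lemma irrep_highest_vector:
  assumes "irrep l W"
  obtains v where "v \<in> W" "v \<noteq> 0" "E v = 0" "H v = scl (of_nat l) v"
  using assms by (auto simp: irreducible_of_highest_weight_def)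

text \<open>Among the spanning vectors \<open>F^k v\<close>, of weights \<mu> - 2k, only
  \<open>v\<close> itself has weight \<mu>.\<close>

lemma irrep_weight_space:
  assumes W: "irrep l W" and v: "v \<in> W" "v \<noteq> 0" "E v = 0" "H v = scl \<mu> v"
    and w: "w \<in> W" "H w = scl \<mu> w"
  shows "\<exists>c. w = scl c v"
proof -
  let ?g = "\<lambda>k. (F ^^ k) v"
  have "range ?g = insert v (?g ` {1..})"
  proof -
    have "range ?g = ?g ` insert 0 {1..}" by (rule arg_cong[where f = "image ?g"]) auto
    then show ?thesis by (simp only: image_insert funpow_0)
  qed
  then have "w \<in> span (insert v (?g ` {1..}))"
    using w(1) irrep_eq_span[OF W v] by simp
  then obtain c where "w - scl c v \<in> span (?g ` {1..})"
    unfolding span_insert by auto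
  then obtain t u where t: "finite t" "t \<subseteq> ?g ` {1..}" "w - scl c v = (\<Sum>a\<in>t. scl (u a) a)"
    unfolding span_explicit by blast
  obtain K where K: "K \<subseteq> {1..}" "inj_on ?g K" "t = ?g ` K"
    using t(2) unfolding subset_image_inj by blast
  have fK: "finite K" using t(1) K(2,3) by (simp add: finite_image_iff)
  \<comment> \<open>The relation between \<open>w\<close>, \<open>v\<close> and the lower vectors
    becomes a vanishing sum of eigenvectors of distinct weights; slot 0 collects everything of
    weight \<mu>.\<close>
  define x where "x = (\<lambda>k. if k = 0 then scl c v - w else scl (u (?g k)) (?g k))"
  have "x 0 = 0"
  proof (rule eigenvectors_sum_zero[of "insert 0 K" "\<lambda>k. \<mu> - 2 * of_nat k"])
    show "inj_on (\<lambda>k. \<mu> - 2 * of_nat k) (insert 0 K)" by (auto simp: inj_on_def)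
    show "H (x k) = scl (\<mu> - 2 * of_nat k) (x k)" for k
      by (auto simp: x_def act_diff act_scale_right H_F_power[OF v(3,4)] v(4) w(2) scale_right_diff_distrib mult.commute)
    have 0: "0 \<notin> K" using K(1) by auto
    have "(\<Sum>k\<in>K. x k) = (\<Sum>k\<in>K. scl (u (?g k)) (?g k))"
      by (rule sum.cong) (use 0 in \<open>auto simp: x_def\<close>)
    also have "\<dots> = w - scl c v"
      by (simp add: t(3) K(3) sum.reindex[OF K(2)])
    finally show "sum x (insert 0 K) = 0"
      using fK 0 by (simp add: x_def)
  qed (use fK in auto)
  then show ?thesis by (auto simp: x_def)
qed

text \<open>\<open>S\<close> sends a highest weight vector into the one-dimensional highest weight
  space, which yields the scalar; the equation then spreads over \<open>W\<close>.\<close>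

lemma schur_scalar:
  assumes S: "equivariant S" and W: "irrep l W" and SW: "\<And>x. x \<in> W \<Longrightarrow> S x \<in> W"
  shows "\<exists>c. \<forall>x\<in>W. S x = scl c x"
proof -
  obtain v where v: "v \<in> W" "v \<noteq> 0" "E v = 0" "H v = scl (of_nat l) v"
    by (rule irrep_highest_vector[OF W])
  have "H (S v) = scl (of_nat l) (S v)"
    using equivariantD(2,3)[OF S] v(4) by metis
  then obtain c where c: "S v = scl c v"
    using irrep_weight_space[OF W v SW[OF v(1)]] by blast
  have "S x = scl c x" if "x \<in> W" for x
    by (rule irrep_invariant_predicate[OF W _ _ _ v(1) _ v(2) that])
      (simp_all add: equivariantD[OF S] c scale_right_distrib act_scale_right mult.commute)
  then show ?thesis by blast
qed

lemma equivariant_surj: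
  assumes S: "equivariant S" and W: "irrep l W" and W': "irrep m W'"
    and SW: "\<And>x. x \<in> W \<Longrightarrow> S x \<in> W'" and v: "v \<in> W" "S v \<noteq> 0"
  shows "S ` W = W'"
proof (rule irrep_cases[OF W', where x = "S v"])
  note sm = submoduleD[OF irrep_submodule[OF W]]
  have "subspace (S ` W)"
  proof (rule subspaceI)
    show "0 \<in> S ` W"
      by (rule image_eqI[of _ _ 0]) (simp_all add: sm(3) equivariantD(4)[OF S])
  next
    fix x y assume "x \<in> S ` W" "y \<in> S ` W"
    then show "x + y \<in> S ` W"
      by (auto simp: equivariantD(1)[OF S, symmetric] intro!: imageI sm(5))
  next
    fix c x assume "x \<in> S ` W"
    then show "scl c x \<in> S ` W"
      by (auto simp: equivariantD(2)[OF S, symmetric] intro!: imageI sm(4))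
  qed
  then show "sl2_submodule scl act (S ` W)"
    unfolding sl2_submodule_def
    by (auto simp: equivariantD(3)[OF S, symmetric] intro!: imageI sm(2))
qed (use SW v in auto)

end

section \<open>Highest weights in finite dimension\<close>

locale findim_sl2_module = sl2_module +
  assumes finite_dim: "\<exists>B. finite B \<and> span B = UNIV"
begin

text \<open>The Casimir eigenvalue alone allows \<mu> to be l or -l - 2; finite dimension excludes
  the negative value.\<close>

lemma primitive_weight:
  assumes W: "irrep l W" and v: "v \<in> W" "E v = 0" "H v = scl \<mu> v" "v \<noteq> 0"
  shows "\<mu> = of_nat l"
proof -
  obtain B where "finite B" "span B = UNIV" using finite_dim by blast
  then obtain m where m: "\<mu> = of_nat m" using primitive_weight_nat v by blast
  have "casimir v = scl (of_nat (m * (m + 2))) v"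
    using casimir_primitive[OF v(2,3)] by (simp only: m of_nat_mult of_nat_add of_nat_numeral)
  then show ?thesis using casimir_eigenvalue_unique[OF W v(1,4)] m by simp
qed

text \<open>For k = l the factor \<mu> - k vanishes, so \<open>F^(l+1) v\<close> is killed by
  \<open>E\<close> and has weight -l - 2; a non-zero such vector would need weight l.\<close>

lemma F_power_Suc_weight:
  assumes W: "irrep l W" and v: "v \<in> W" "E v = 0" "H v = scl (of_nat l) v"
  shows "(F ^^ Suc l) v = 0"
proof (rule ccontr)
  assume nz: "(F ^^ Suc l) v \<noteq> 0"
  have "E ((F ^^ Suc l) v) = 0"
    using E_F_power[OF v(2,3), of l] by simp
  then have "of_nat l - 2 * of_nat (Suc l) = (of_nat l :: complex)"
    using primitive_weight[OF W funpow_F_mem[OF irrep_submodule[OF W] v(1)] _ H_F_power[OF v(2,3)] nz]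
    by blast
  then have "(2 * of_nat (Suc l) :: complex) = 0"
    by (simp del: of_nat_Suc)
  then show False by (simp del: of_nat_Suc)
qed

lemma trivial_irrep:
  assumes W: "irrep 0 W" and "x \<in> W"
  shows "act a x = 0"
proof -
  obtain v where v: "v \<in> W" "v \<noteq> 0" "E v = 0" "H v = scl (of_nat 0) v"
    by (rule irrep_highest_vector[OF W])
  have Fv: "F v = 0" using F_power_Suc_weight[OF W v(1,3,4)] by simp
  have *: "act a v = 0" for a
    by (rule act_expand[of a]) (simp add: Fv v)
  have "\<forall>a. act a x = 0"
    by (rule irrep_invariant_predicate[OF W _ _ _ v(1) _ v(2) \<open>x \<in> W\<close>])
      (simp_all add: * act_add_right act_scale_right)
  then show ?thesis by blast
qed

text \<open>The product of modules of highest weight 6 contains a single copy of the one of highest weight 2,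
  and it is alternating. With \<open>v\<^sub>k = F^k v\<close>, the values \<open>B v\<^sub>i v\<^sub>j\<close> with \<open>i + j \<le> 4\<close> have
  too large a weight; applying \<open>F\<close> to those with \<open>i + j = 4\<close> shows that \<open>B v\<^sub>i v\<^sub>j\<close> is antisymmetric
  for \<open>i + j = 5\<close>.\<close>

lemma symmetric_product_weights_6_2:
  fixes B :: "'a \<Rightarrow> 'a \<Rightarrow> 'a"
  assumes U: "irrep 6 U" and W: "irrep 2 W"
    and add_left: "\<And>x y z. B (x + y) z = B x z + B y z"
    and add_right: "\<And>x y z. B x (y + z) = B x y + B x z"
    and scale_left: "\<And>c x y. B (scl c x) y = scl c (B x y)"
    and scale_right: "\<And>c x y. B x (scl c y) = scl c (B x y)"
    and act: "\<And>a x y. act a (B x y) = B (act a x) y + B x (act a y)"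
    and BW: "\<And>x y. x \<in> U \<Longrightarrow> y \<in> U \<Longrightarrow> B x y \<in> W"
    and sym: "\<And>x y. x \<in> U \<Longrightarrow> y \<in> U \<Longrightarrow> B x y = B y x"
    and xy: "x \<in> U" "y \<in> U"
  shows "B x y = 0"
proof -
  obtain v where v: "v \<in> U" "v \<noteq> 0" "E v = 0" "H v = scl (of_nat 6) v"
    by (rule irrep_highest_vector[OF U])
  let ?v = "\<lambda>k. (F ^^ k) v"
  have vU: "?v k \<in> U" for k by (rule funpow_F_mem[OF irrep_submodule[OF U] v(1)])
  have B0: "B 0 z = 0" "B z 0 = 0" for z
    using scale_left[of 0 0 z] scale_right[of z 0 0] by simp_all
  have Hv: "H (B v (?v j)) = scl (12 - 2 * of_nat j) (B v (?v j))" for j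
  proof -
    have "H (B v (?v j)) = scl 6 (B v (?v j)) + scl (6 - 2 * of_nat j) (B v (?v j))"
      using H_F_power[OF v(3,4), of j] v(4) by (simp add: act scale_left scale_right)
    then show ?thesis by (simp only: scale_left_distrib[symmetric]) (simp add: algebra_simps)
  qed
  \<comment> \<open>A non-zero vector killed by \<open>E\<close> must have weight 2, and 12 - 2j = 2
    only for j = 5.\<close>
  have prim: "B v (?v j) = 0" if "E (B v (?v j)) = 0" "j \<noteq> 5" for j
  proof (rule ccontr)
    assume "B v (?v j) \<noteq> 0"
    then have "12 - 2 * of_nat j = (of_nat 2 :: complex)"
      using primitive_weight[OF W BW[OF v(1) vU] that(1) Hv] by blast
    then have "(of_nat j :: complex) = of_nat 5" by simp
    then show False using that(2) by (simp only: of_nat_eq_iff)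
  qed
  have EB: "E (B v (?v (Suc j))) = scl (of_nat (Suc j) * (6 - of_nat j)) (B v (?v j))" for j
    using E_F_power[OF v(3,4), of j] v(3) by (simp only: act B0 scale_right) simp
  have b0: "B v (?v j) = 0" if "j \<le> 4" for j
    using that
  proof (induction j)
    case 0
    show ?case by (rule prim) (use v(3) in \<open>auto simp: act B0\<close>)
  next
    case (Suc j)
    show ?case by (rule prim, unfold EB) (use Suc in auto)
  qed
  have FB: "F (B (?v i) (?v j)) = B (?v (Suc i)) (?v j) + B (?v i) (?v (Suc j))" for i j
    by (simp add: act)
  have b1: "B (?v 1) (?v j) = 0" if "j \<le> 3" for j
    using FB[of 0 j] b0[of j] b0[of "Suc j"] that by simp
  have b2: "B (?v 2) (?v j) = 0" if "j \<le> 2" for j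
    using FB[of 1 j] b1[of j] b1[of "Suc j"] that by (simp add: numeral_2_eq_2)
  have "B (?v 3) (?v 2) + B (?v 2) (?v 3) = 0"
    using FB[of 2 2] b2[of 2] by (simp add: numeral_3_eq_3 numeral_2_eq_2)
  \<comment> \<open>Antisymmetry against symmetry kills the middle pair; applying \<open>F\<close>
    to the vanishing values of degree 4 carries this to \<open>B v (?v 5)\<close>.\<close>
  then have "scl 2 (B (?v 2) (?v 3)) = 0"
    using sym[OF vU vU, of 3 2] by (simp add: scl_two)
  then have "B (?v 2) (?v 3) = 0" by simp
  then have "B (?v 1) (?v 4) = 0"
    using FB[of 1 3] b1[of 3] by (simp add: numeral_2_eq_2 eval_nat_numeral)
  then have b5: "B v (?v 5) = 0"
    using FB[of 0 4] b0[of 4] by (simp add: eval_nat_numeral)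
  \<comment> \<open>Its image under \<open>E\<close> is a multiple of the value at 5, so
    \<open>E\<close> kills it, and its weight is 0 instead of 2.\<close>
  have b6: "B v (?v 6) = 0"
    by (rule prim) (use EB[of 5] b5 in \<open>simp_all add: eval_nat_numeral\<close>)
  have "?v (k + 7) = 0" for k
    using F_power_Suc_weight[OF U v(1,3,4)] by (simp only: funpow_add) (induction k, simp_all)
  then have b7: "B v (?v k) = 0" if "k \<ge> 7" for k
    using that B0 by (metis add.commute le_Suc_ex)
  have bv: "B v (?v k) = 0" for k
  proof -
    consider "k \<le> 4" | "k = 5" | "k = 6" | "k \<ge> 7" by linarith
    then show ?thesis using b0 b5 b6 b7 by cases auto
  qed
  have bvy: "B v y = 0" if "y \<in> U" for y
  proof -
    have "y \<in> span (range ?v)"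
      using that irrep_eq_span[OF U v] by simp
    then show ?thesis
      by (induction rule: span_induct_alt) (auto simp: B0 add_right scale_right bv)
  qed
  \<comment> \<open>When \<open>z\<close> annihilates \<open>U\<close>, both terms on the right
    vanish for \<open>y\<close> in \<open>U\<close>, as \<open>act a y\<close> stays in
    \<open>U\<close>.\<close>
  have BF: "B (act a z) y = act a (B z y) - B z (act a y)" for a z y
    by (simp add: act)
  have "\<forall>y\<in>U. B x y = 0"
    by (rule irrep_invariant_predicate[OF U _ _ _ v(1) _ v(2) xy(1)])
      (auto simp: bvy add_left scale_left BF submoduleD(2)[OF irrep_submodule[OF U]])
  then show ?thesis using xy(2) by blast
qed

end

section \<open>Direct sums of irreducible modules\<close>

locale sl2_direct_sum = findim_sl2_module scl act
  for scl :: "complex \<Rightarrow> 'v::ab_group_add \<Rightarrow> 'v" and act +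
  fixes n :: nat and lam :: "nat \<Rightarrow> nat" and L :: "nat \<Rightarrow> 'v set"
  assumes direct_sum: "internal_direct_sum n L"
    and irreps: "i \<in> {1..n} \<Longrightarrow> irrep (lam i) (L i)"
begin

text \<open>\<open>THE\<close> picks the unique decomposition. It is extensional, so indices outside
  \<open>{1..n}\<close> give \<open>undefined\<close>.\<close>

definition proj :: "nat \<Rightarrow> 'v \<Rightarrow> 'v" where
  "proj i x = (THE f. f \<in> (\<Pi>\<^sub>E i\<in>{1..n}. L i) \<and> x = (\<Sum>i\<in>{1..n}. f i)) i"

lemma proj_spec: "(\<lambda>i. proj i x) \<in> (\<Pi>\<^sub>E i\<in>{1..n}. L i) \<and> x = (\<Sum>i\<in>{1..n}. proj i x)"
proof -
  have "\<exists>!f. f \<in> (\<Pi>\<^sub>E i\<in>{1..n}. L i) \<and> x = (\<Sum>i\<in>{1..n}. f i)"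
    using direct_sum unfolding internal_direct_sum_def by (rule spec)
  then show ?thesis
    unfolding proj_def by (rule theI')
qed

lemma proj_mem: "i \<in> {1..n} \<Longrightarrow> proj i x \<in> L i"
  using proj_spec[of x] by (auto simp: PiE_iff)

lemma sum_proj: "(\<Sum>i\<in>{1..n}. proj i x) = x"
  using proj_spec[of x] by simp

lemma proj_eqI:
  assumes g: "\<And>i. i \<in> {1..n} \<Longrightarrow> g i \<in> L i" and x: "x = (\<Sum>i\<in>{1..n}. g i)" and i: "i \<in> {1..n}"
  shows "proj i x = g i"
proof -
  have "\<exists>!f. f \<in> (\<Pi>\<^sub>E i\<in>{1..n}. L i) \<and> x = (\<Sum>i\<in>{1..n}. f i)"
    using direct_sum unfolding internal_direct_sum_def by (rule spec)
  moreover have "restrict g {1..n} \<in> (\<Pi>\<^sub>E i\<in>{1..n}. L i) \<and> x = (\<Sum>i\<in>{1..n}. restrict g {1..n} i)"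
    using g by (simp add: x)
  ultimately have "(THE f. f \<in> (\<Pi>\<^sub>E i\<in>{1..n}. L i) \<and> x = (\<Sum>i\<in>{1..n}. f i)) = restrict g {1..n}"
    by (rule the1_equality[where P = "\<lambda>f. f \<in> (\<Pi>\<^sub>E i\<in>{1..n}. L i) \<and> x = sum f {1..n}"])
  then have "proj i x = restrict g {1..n} i"
    by (simp only: proj_def)
  then show ?thesis using i by simp
qed

lemma submodule_L:
  assumes "i \<in> {1..n}"
  shows "0 \<in> L i" "x \<in> L i \<Longrightarrow> scl c x \<in> L i" "x \<in> L i \<Longrightarrow> y \<in> L i \<Longrightarrow> x + y \<in> L i"
    "x \<in> L i \<Longrightarrow> - x \<in> L i" "x \<in> L i \<Longrightarrow> act a x \<in> L i"
  using submoduleD[OF irrep_submodule[OF irreps[OF assms]]] by simp_all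

lemma proj_L:
  assumes "x \<in> L j" "j \<in> {1..n}" "i \<in> {1..n}"
  shows "proj i x = (if i = j then x else 0)"
proof (rule proj_eqI)
  show "x = (\<Sum>i\<in>{1..n}. if i = j then x else 0)"
    using assms(2) by simp
qed (use assms submodule_L(1) in auto)

lemma additive_eq_0:
  fixes f :: "'v \<Rightarrow> 'w::ab_group_add"
  assumes add: "\<And>x y. f (x + y) = f x + f y" and L: "\<And>i x. i \<in> {1..n} \<Longrightarrow> x \<in> L i \<Longrightarrow> f x = 0"
  shows "f x = 0"
proof -
  have "f 0 = 0" using add[of 0 0] by simp
  then have sum: "f (sum g I) = (\<Sum>i\<in>I. f (g i))" for g :: "nat \<Rightarrow> 'v" and I
    by (induction I rule: infinite_finite_induct) (simp_all add: add)
  have "f (\<Sum>i\<in>{1..n}. proj i x) = 0"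
    unfolding sum by (rule sum.neutral) (use L proj_mem in blast)
  then show ?thesis by (simp only: sum_proj)
qed

lemma equivariant_proj:
  assumes i: "i \<in> {1..n}"
  shows "equivariant (proj i)"
  unfolding equivariant_def
proof (intro conjI allI)
  show "proj i (x + y) = proj i x + proj i y" for x y
    by (rule proj_eqI[OF _ _ i]) (simp_all add: submodule_L proj_mem sum.distrib sum_proj del: atLeastAtMost_iff One_nat_def)
  show "proj i (scl c x) = scl c (proj i x)" for c x
    by (rule proj_eqI[OF _ _ i])
      (simp_all add: submodule_L proj_mem scale_sum_right[symmetric] sum_proj del: atLeastAtMost_iff One_nat_def)
  show "proj i (act a x) = act a (proj i x)" for a x
    by (rule proj_eqI[OF _ _ i])
      (simp_all add: submodule_L proj_mem act_sum[symmetric] sum_proj del: atLeastAtMost_iff One_nat_def)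
qed

text \<open>Each component is a cocycle. A non-trivial summand has non-zero Casimir eigenvalue, so
  \<open>cocycle_is_coboundary\<close> applies; on trivial summands cocycles vanish because sl2 is
  spanned by its brackets.\<close>

lemma whitehead:
  assumes add: "\<And>a b. \<phi> (a + b) = \<phi> a + \<phi> b"
    and scale: "\<And>c a. \<phi> (sl2_scale c a) = scl c (\<phi> a)"
    and cocycle: "\<And>a b. \<phi> (sl2_bracket a b) = act a (\<phi> b) - act b (\<phi> a)"
  shows "\<exists>x. \<forall>a. \<phi> a = act a x"
proof -
  have "\<exists>x. \<forall>a. proj i (\<phi> a) = act a x" if i: "i \<in> {1..n}" for i
  proof -
    note eq = equivariantD[OF equivariant_proj[OF i]]
    have diff: "proj i (x - y) = proj i x - proj i y" for x y
      using eq(1)[of "x - y" y] by simp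
    show ?thesis
    proof (cases "lam i = 0")
      case True
      then have triv: "act a (proj i x) = 0" for a x
        using trivial_irrep[of "L i"] irreps[OF i] proj_mem[OF i] by simp
      have br0: "proj i (\<phi> (sl2_bracket a b)) = 0" for a b
        by (simp add: cocycle diff eq triv)
      have "proj i (\<phi> sl2_e) = 0" "proj i (\<phi> sl2_f) = 0" "proj i (\<phi> sl2_h) = 0"
        using br0[of sl2_h sl2_e] br0[of sl2_h sl2_f] br0[of sl2_e sl2_f]
        by (simp_all add: sl2_relations scale eq del: sl2.scale_minus_left scale_minus_left)
      then have "proj i (\<phi> a) = act a 0" for a
        using sl2_expand[of a] by (auto simp: add scale eq)
      then show ?thesis by blast
    next
      case False
      show ?thesis
      proof (rule cocycle_is_coboundary)
        show "casimir (proj i (\<phi> a)) = scl (of_nat (lam i * (lam i + 2))) (proj i (\<phi> a))" for a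
          by (rule casimir_irrep[OF irreps[OF i] proj_mem[OF i]])
        show "of_nat (lam i * (lam i + 2)) \<noteq> (0 :: complex)"
          using False by (simp only: of_nat_eq_0_iff) simp
      qed (simp_all add: add scale cocycle diff eq)
    qed
  qed
  then obtain g where g: "\<And>i a. i \<in> {1..n} \<Longrightarrow> proj i (\<phi> a) = act a (g i)" by metis
  have "\<phi> a = act a (\<Sum>i\<in>{1..n}. g i)" for a
  proof -
    have "\<phi> a = (\<Sum>i\<in>{1..n}. proj i (\<phi> a))" by (simp only: sum_proj)
    also have "\<dots> = (\<Sum>i\<in>{1..n}. act a (g i))" by (rule sum.cong) (simp_all add: g)
    finally show ?thesis by (simp only: act_sum)
  qed
  then show ?thesis by blast
qed

lemma equivariant_isotypic:
  assumes S: "equivariant S" and i: "i \<in> {1..n}" and x: "x \<in> L i" and I: "I \<subseteq> {1..n}"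
    and lam: "\<And>j. j \<in> {1..n} - I \<Longrightarrow> lam j \<noteq> lam i"
  shows "S x = (\<Sum>j\<in>I. proj j (S x))"
proof -
  have "proj j (S x) = 0" if "j \<in> {1..n} - I" for j
    using that lam[OF that] proj_mem
    by (intro equivariant_zero[OF equivariant_comp[OF equivariant_proj S] irreps[OF i] irreps _ x]) auto
  then have "(\<Sum>j\<in>I. proj j (S x)) = (\<Sum>j\<in>{1..n}. proj j (S x))"
    by (intro sum.mono_neutral_left) (use I in auto)
  then show ?thesis by (simp only: sum_proj)
qed

lemma equivariant_scalar_component:
  assumes S: "equivariant S" and i: "i \<in> {1..n}"
  obtains c where "\<And>x. x \<in> L i \<Longrightarrow> proj i (S x) = scl c x"
  using schur_scalar[OF equivariant_comp[OF equivariant_proj[OF i] S] irreps[OF i]] proj_mem[OF i]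
  by blast

end

section \<open>Equivariant derivations\<close>

locale sl2_example = lie_action_by_derivations sl2_scale sl2_bracket scl br act
  for scl :: "complex \<Rightarrow> 'n::ab_group_add \<Rightarrow> 'n" and br and act +
  fixes n :: nat and r :: "nat \<Rightarrow> nat" and L :: "nat \<Rightarrow> 'n set"
  assumes n: "n \<ge> 6"
    and r: "\<forall>j\<in>{7..n}. r j \<ge> 4" "inj_on r {7..n}"
    and direct_sum: "internal_direct_sum n L"
    and irreps: "\<forall>i\<in>{1..n}. irreducible_of_highest_weight scl act (highest_weights r i) (L i)"
    and products: "prescribed_products scl br n L"
    and nondegenerate: "nondegenerate_products br L"
begin

sublocale M: sl2_direct_sum scl act n "highest_weights r" L
proof unfold_locales
  show "\<exists>B. finite B \<and> N.span B = UNIV" by (rule N.finite_dim)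
qed (use direct_sum irreps in \<open>simp_all add: act_add_left act_add_right act_scale_left act_scale_right act_bracket\<close>)

lemmas bilinear = N.br_add_left N.br_add_right N.br_scale_left N.br_scale_right

lemma br_zero [simp]: "br 0 x = 0" "br x 0 = 0"
  using N.br_scale_left[of 0 0 x] N.br_scale_right[of x 0 0] by simp_all

section \<open>Weights and products of the summands\<close>

lemma weights:
  "highest_weights r (Suc 0) = 6" "highest_weights r 2 = 4" "highest_weights r 3 = 6"
  "highest_weights r 4 = 2" "highest_weights r 5 = 4" "highest_weights r 6 = 0"
  by (simp_all add: highest_weights_def)

lemma weights_7: "j \<in> {7..n} \<Longrightarrow> highest_weights r j \<ge> 8"
  using r(1) by (auto simp: highest_weights_def)

text \<open>The weights for j \<ge> 7 are at least 8 and distinct, so repetitions occur only for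
  weight 6 at 1, 3 and weight 4 at 2, 5.\<close>

lemma weights_distinct:
  assumes "i \<in> {1..n}" "j \<in> {1..n}" "i \<noteq> j" "{i, j} \<noteq> {1, 3}" "{i, j} \<noteq> {2, 5}"
  shows "highest_weights r i \<noteq> highest_weights r j"
proof (cases "i \<in> {7..n}"; cases "j \<in> {7..n}")
  assume "i \<in> {7..n}" "j \<in> {7..n}"
  then show ?thesis using r(2) assms(3) by (auto simp: highest_weights_def inj_on_def)
next
  assume i: "i \<in> {7..n}" and "j \<notin> {7..n}"
  then have "j \<in> {1, 2, 3, 4, 5, 6}" using assms(2) by auto
  then show ?thesis using weights_7[OF i] by (auto simp: weights)
next
  assume "i \<notin> {7..n}" and j: "j \<in> {7..n}"
  then have "i \<in> {1, 2, 3, 4, 5, 6}" using assms(1) by auto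
  then show ?thesis using weights_7[OF j] by (auto simp: weights)
next
  assume "i \<notin> {7..n}" "j \<notin> {7..n}"
  then have "i \<in> {1, 2, 3, 4, 5, 6}" "j \<in> {1, 2, 3, 4, 5, 6}" using assms(1,2) by auto
  then show ?thesis using assms(3-5) by (auto simp: weights)
qed

text \<open>\<open>I\<close> has to include the possible partner of \<open>i\<close> of equal
  weight.\<close>

lemma isotypic:
  assumes S: "M.equivariant S" and i: "i \<in> {1..n}" and x: "x \<in> L i" and I: "i \<in> I" "I \<subseteq> {1..n}"
    and "i \<in> {1, 3} \<Longrightarrow> {1, 3} \<subseteq> I" "i \<in> {2, 5} \<Longrightarrow> {2, 5} \<subseteq> I"
  shows "S x = (\<Sum>j\<in>I. M.proj j (S x))"
proof (rule M.equivariant_isotypic[OF S i x I(2)])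
  fix j assume "j \<in> {1..n} - I"
  then show "highest_weights r j \<noteq> highest_weights r i"
    using assms by (intro weights_distinct) (auto simp: doubleton_eq_iff)
qed

lemma product_spans:
  "product_span scl br (L 1) (L 1) = L 3" "product_span scl br (L 2) (L 5) = L 6"
  "i \<in> {2, 3, 5} \<Longrightarrow> product_span scl br (L 1) (L i) = L 4"
  "k \<in> {2, 5} \<union> {7..n} \<Longrightarrow> product_span scl br (L k) (L k) = L 4"
  using products unfolding prescribed_products_def by auto

lemma br_mem: "product_span scl br (L i) (L j) = L k \<Longrightarrow> x \<in> L i \<Longrightarrow> y \<in> L j \<Longrightarrow> br x y \<in> L k"
  unfolding product_span_def by (blast intro: N.span_base)

lemma br_mem_swap:
  assumes "product_span scl br (L i) (L j) = L k" "k \<in> {1..n}" "x \<in> L j" "y \<in> L i"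
  shows "br x y \<in> L k"
  using M.submodule_L(4)[OF assms(2) br_mem[OF assms(1,4,3)]] by (simp add: N.br_swap[of y x])

lemma exists_br_nonzero:
  assumes "product_span scl br (L i) (L j) = L k" "k \<in> {1..n}"
  shows "\<exists>x\<in>L i. \<exists>y\<in>L j. br x y \<noteq> 0"
proof (rule ccontr)
  assume "\<not> ?thesis"
  then have "{br x y |x y. x \<in> L i \<and> y \<in> L j} \<subseteq> {0}" by blast
  then have "N.span {br x y |x y. x \<in> L i \<and> y \<in> L j} \<subseteq> N.span {0}" by (rule N.span_mono)
  then have "L k \<subseteq> {0}" using assms(1) by (simp add: product_span_def)
  then show False using M.irrep_nonzero[OF M.irreps[OF assms(2)]] by blast
qed

lemma scalar_on_product:
  assumes "product_span scl br (L i) (L j) = L k" and T: "M.equivariant T"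
    and "\<And>x y. x \<in> L i \<Longrightarrow> y \<in> L j \<Longrightarrow> T (br x y) = scl c (br x y)" and "z \<in> L k"
  shows "T z = scl c z"
proof -
  have "z \<in> N.span {br x y |x y. x \<in> L i \<and> y \<in> L j}"
    using assms(1,4) by (simp add: product_span_def)
  then show ?thesis
  proof (induction rule: N.span_induct_alt)
    case base
    then show ?case by (simp add: M.equivariantD[OF T])
  next
    case (step d x y)
    then have "T x = scl c x" using assms(3) by blast
    then show ?case
      by (simp add: M.equivariantD[OF T] step N.scale_right_distrib mult.commute)
  qed
qed

text \<open>The vectors of \<open>L i\<close> centralized by \<open>L 1\<close> form a submodule;
  were it non-zero, it would be \<open>L i\<close>, and then \<open>L 4\<close> would
  vanish.\<close>

lemma centralizer_of_L1:
  assumes i: "i \<in> {2, 3, 5}" and x: "x \<in> L i" and c: "\<And>z. z \<in> L 1 \<Longrightarrow> br z x = 0"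
  shows "x = 0"
proof (rule ccontr)
  assume "x \<noteq> 0"
  have i': "i \<in> {1..n}" using i n by auto
  have 1: "1 \<in> {1..n}" using n by auto
  have 4: "4 \<in> {1..n}" using n by auto
  have "\<forall>z\<in>L 1. br z y = 0" if "y \<in> L i" for y
  proof (rule M.irrep_invariant_predicate[OF M.irreps[OF i'] _ _ _ x _ \<open>x \<noteq> 0\<close> that])
    fix a y assume "\<forall>z\<in>L 1. br z y = 0"
    \<comment> \<open>Apply \<open>act a\<close> to \<open>br z y = 0\<close>: the term
      \<open>br (act a z) y\<close> vanishes because \<open>act a z\<close> stays in
      \<open>L 1\<close>.\<close>
    then show "\<forall>z\<in>L 1. br z (act a y) = 0"
      using act_derivation[of a _ y] M.submodule_L(5)[OF 1] by (metis M.act_zero add_0)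
  qed (use c in \<open>auto simp: bilinear\<close>)
  then show False
    using exists_br_nonzero[OF product_spans(3)[OF i] 4] by blast
qed

section \<open>Scalars and mixing of an equivariant derivation\<close>

context
  fixes T
  assumes T: "M.equivariant T" and der: "\<And>x y. T (br x y) = br (T x) y + br x (T y)"
begin

text \<open>\<open>\<iota>\<close> is the part of \<open>T\<close> from \<open>L 1\<close> to
  \<open>L 3\<close>. The \<open>L 4\<close> component of \<open>T (br x y)\<close> shows that
  \<open>br (\<iota> x) y\<close> is symmetric in \<open>x\<close> and \<open>y\<close>, hence zero
  by \<open>symmetric_product_weights_6_2\<close>; so \<open>\<iota> x\<close> centralizes
  \<open>L 1\<close> and vanishes.\<close>

lemma T_L1: "\<exists>a. \<forall>x\<in>L 1. T x = scl a x"
proof -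
  have i: "1 \<in> {1..n}" "3 \<in> {1..n}" "4 \<in> {1..n}" using n by auto
  define \<iota> where "\<iota> = (\<lambda>x. M.proj 3 (T x))"
  have \<iota>: "M.equivariant \<iota>"
    unfolding \<iota>_def by (rule M.equivariant_comp[OF M.equivariant_proj[OF i(2)] T])
  have \<iota>3: "\<iota> x \<in> L 3" for x
    unfolding \<iota>_def by (rule M.proj_mem[OF i(2)])
  obtain a where a: "\<And>x. x \<in> L 1 \<Longrightarrow> M.proj 1 (T x) = scl a x"
    using M.equivariant_scalar_component[OF T i(1)] by blast
  have T13: "T x = M.proj 1 (T x) + \<iota> x" if "k \<in> {1, 3}" "x \<in> L k" for x k
  proof -
    have "T x = (\<Sum>j\<in>{1, 3}. M.proj j (T x))"
      by (rule isotypic[OF T _ that(2)]) (use that i in auto)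
    then show ?thesis by (simp add: \<iota>_def)
  qed
  have p13: "M.proj 4 x = 0" if "x \<in> L 1 \<or> x \<in> L 3" for x
    using that i M.proj_L[of x _ 4] by auto
  note proj4 = M.equivariantD[OF M.equivariant_proj[OF i(3)]]
  have sum: "br (\<iota> x) y + br x (\<iota> y) = 0" if xy: "x \<in> L 1" "y \<in> L 1" for x y
  proof -
    have xy3: "br x y \<in> L 3" by (rule br_mem[OF product_spans(1) xy])
    \<comment> \<open>\<open>T\<close> keeps \<open>br x y\<close> inside \<open>L 1\<close> plus
      \<open>L 3\<close>, which has no \<open>L 4\<close> component.\<close>
    have "M.proj 4 (T (br x y)) = M.proj 4 (M.proj 1 (T (br x y))) + M.proj 4 (\<iota> (br x y))"
      by (subst T13[OF _ xy3]) (simp_all add: proj4)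
    then have "M.proj 4 (T (br x y)) = 0"
      using p13 M.proj_mem[OF i(1)] \<iota>3 by simp
    moreover have "T (br x y) = scl a (br x y) + scl a (br x y) + (br (\<iota> x) y + br x (\<iota> y))"
      unfolding der using T13[of 1 x] T13[of 1 y] xy a
      by (simp add: bilinear add_ac)
    moreover have "M.proj 4 (br (\<iota> x) y + br x (\<iota> y)) = br (\<iota> x) y + br x (\<iota> y)"
      using br_mem[OF product_spans(3)[of 3] xy(1) \<iota>3[of y]]
        br_mem_swap[OF product_spans(3)[of 3] i(3) \<iota>3[of x] xy(2)] i
      by (auto simp: proj4 M.proj_L[of _ 4 4])
    ultimately show ?thesis
      using p13[of "br x y"] xy3 by (simp add: proj4)
  qed
  have W6: "M.irrep 6 (L 1)" and W2: "M.irrep 2 (L 4)"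
    using M.irreps[OF i(1)] M.irreps[OF i(3)] by (simp_all add: weights)
  have B: "br (\<iota> x) y = 0" if "x \<in> L 1" "y \<in> L 1" for x y
  proof (rule M.symmetric_product_weights_6_2[OF W6 W2, where B = "\<lambda>x y. br (\<iota> x) y"])
    show "br (\<iota> x) y \<in> L 4" if "x \<in> L 1" "y \<in> L 1" for x y
      by (rule br_mem_swap[OF product_spans(3)[of 3] i(3) \<iota>3 that(2)]) simp
    show "br (\<iota> x) y = br (\<iota> y) x" if "x \<in> L 1" "y \<in> L 1" for x y
      using sum[OF that] by (simp add: eq_neg_iff_add_eq_0 N.br_swap[of "\<iota> y" x])
  qed (use that in \<open>simp_all add: M.equivariantD[OF \<iota>] bilinear act_derivation\<close>)
  have "\<iota> x = 0" if x: "x \<in> L 1" for x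
  proof (rule centralizer_of_L1[of 3, OF _ \<iota>3])
    show "br z (\<iota> x) = 0" if "z \<in> L 1" for z
      by (subst N.br_swap) (simp add: B[OF x that])
  qed simp
  then have "T x = scl a x" if "x \<in> L 1" for x
    using T13[of 1 x] a that by simp
  then show ?thesis by blast
qed

text \<open>\<open>R\<close> stands for the part of \<open>T\<close> that leaves \<open>L k\<close>.
  Its products land in \<open>L 6\<close>, so the \<open>L 4\<close> component of the Leibniz rule
  sees only the scalars.\<close>

lemma T_on_square:
  assumes "product_span scl br (L k) (L k) = L 4" and T4: "\<And>x. x \<in> L 4 \<Longrightarrow> T x = scl b x"
    and Tk: "\<And>x. x \<in> L k \<Longrightarrow> T x = scl c x + R x"
    and R: "\<And>x y. x \<in> L k \<Longrightarrow> y \<in> L k \<Longrightarrow> br (R x) y \<in> L 6 \<and> br x (R y) \<in> L 6"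
  shows "b = 2 * c"
proof -
  have i: "4 \<in> {1..n}" "6 \<in> {1..n}" using n by auto
  note proj4 = M.equivariantD[OF M.equivariant_proj[OF i(1)]]
  obtain x y where xy: "x \<in> L k" "y \<in> L k" "br x y \<noteq> 0"
    using exists_br_nonzero[OF assms(1) i(1)] by blast
  have xy4: "br x y \<in> L 4" by (rule br_mem[OF assms(1) xy(1,2)])
  have "scl b (br x y) = scl (2 * c) (br x y) + (br (R x) y + br x (R y))"
    using der[of x y] by (simp add: T4[OF xy4] Tk xy bilinear M.scl_two N.scale_scale[symmetric] add_ac
        del: N.scale_scale)
  then have "M.proj 4 (scl b (br x y)) = M.proj 4 (scl (2 * c) (br x y) + (br (R x) y + br x (R y)))"
    by simp
  moreover have "M.proj 4 (br (R x) y) = 0" "M.proj 4 (br x (R y)) = 0"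
    using R[OF xy(1,2)] i M.proj_L[of _ 6 4] by auto
  ultimately have "scl b (br x y) = scl (2 * c) (br x y)"
    using xy4 i M.proj_L[of "br x y" 4 4] by (simp add: proj4)
  then show ?thesis using xy(3) by (simp only: N.scale_cancel_right) simp
qed

lemma T_component_scalar:
  assumes "i \<in> {4, 6} \<union> {7..n}" "x \<in> L i"
  shows "T x = M.proj i (T x)"
proof -
  have "T x = (\<Sum>j\<in>{i}. M.proj j (T x))"
    by (rule isotypic[OF T _ assms(2)]) (use assms(1) n in auto)
  then show ?thesis by simp
qed

lemma T_zero:
  "T x = 0"
proof -
  have i: "1 \<in> {1..n}" "2 \<in> {1..n}" "3 \<in> {1..n}" "4 \<in> {1..n}" "5 \<in> {1..n}" "6 \<in> {1..n}"
    using n by auto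
  note eqT = M.equivariantD[OF T]
  obtain a where T1: "\<And>x. x \<in> L 1 \<Longrightarrow> T x = scl a x" using T_L1 by blast
  have T3: "T x = scl (2 * a) x" if "x \<in> L 3" for x
  proof (rule scalar_on_product[OF product_spans(1) T _ that])
    show "T (br x y) = scl (2 * a) (br x y)" if "x \<in> L 1" "y \<in> L 1" for x y
      using T1 that by (simp add: der bilinear N.scale_left_distrib[symmetric])
  qed
  have T4: "T x = scl (3 * a) x" if "x \<in> L 4" for x
  proof (rule scalar_on_product[OF product_spans(3)[of 3] T _ that])
    show "T (br x y) = scl (3 * a) (br x y)" if "x \<in> L 1" "y \<in> L 3" for x y
      using T1 T3 that by (simp add: der bilinear N.scale_left_distrib[symmetric])
  qed simp
  \<comment> \<open>On \<open>L 2\<close> plus \<open>L 5\<close>, \<open>T\<close> is a two-by-two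
    block matrix; \<open>P\<close> on \<open>L 2\<close> and \<open>Q\<close> on \<open>L 5\<close>
    are its off-diagonal entries.\<close>
  define P where "P x = M.proj 5 (T x)" for x
  define Q where "Q x = M.proj 2 (T x)" for x
  have P: "M.equivariant P" and Q: "M.equivariant Q"
    unfolding P_def Q_def by (intro M.equivariant_comp[OF M.equivariant_proj T] i)+
  have P5: "P x \<in> L 5" and Q2: "Q x \<in> L 2" for x
    unfolding P_def Q_def by (intro M.proj_mem i)+
  have T25: "T x = Q x + P x" if "k \<in> {2, 5}" "x \<in> L k" for k x
  proof -
    have "T x = (\<Sum>j\<in>{2, 5}. M.proj j (T x))"
      by (rule isotypic[OF T _ that(2)]) (use that i in auto)
    then show ?thesis by (simp add: P_def Q_def)
  qed
  obtain \<alpha> where "\<And>y. y \<in> L 2 \<Longrightarrow> M.proj 2 (T y) = scl \<alpha> y"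
    using M.equivariant_scalar_component[OF T i(2)] by blast
  then have T2: "T y = scl \<alpha> y + P y" if "y \<in> L 2" for y
    using T25[of 2 y] that by (simp add: Q_def)
  obtain \<delta> where "\<And>y. y \<in> L 5 \<Longrightarrow> M.proj 5 (T y) = scl \<delta> y"
    using M.equivariant_scalar_component[OF T i(5)] by blast
  then have T5: "T y = scl \<delta> y + Q y" if "y \<in> L 5" for y
    using T25[of 5 y] that by (simp add: P_def add.commute)
  \<comment> \<open>\<open>P\<close> maps \<open>L 2\<close> to \<open>L 5\<close>, so the extra
    products lie in [L 2, L 5] = L 6.\<close>
  have "3 * a = 2 * \<alpha>"
    using br_mem[OF product_spans(2)] br_mem_swap[OF product_spans(2) i(6)] P5
    by (intro T_on_square[of 2 "3 * a" \<alpha> P] T4 T2 product_spans(4)) auto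
  then have \<alpha>: "\<alpha> = 3 * a / 2" by simp
  have "3 * a = 2 * \<delta>"
    using br_mem[OF product_spans(2)] br_mem_swap[OF product_spans(2) i(6)] Q2
    by (intro T_on_square[of 5 "3 * a" \<delta> Q] T4 T5 product_spans(4)) auto
  then have \<delta>: "\<delta> = 3 * a / 2" by simp
  have T6: "T w = scl (3 * a) w" if "w \<in> L 6" for w
  proof (rule scalar_on_product[OF product_spans(2) T _ that])
    fix y z assume yz: "y \<in> L 2" "z \<in> L 5"
    note proj6 = M.equivariantD[OF M.equivariant_proj[OF i(6)]]
    have yz6: "br y z \<in> L 6" by (rule br_mem[OF product_spans(2) yz])
    \<comment> \<open>The off-diagonal parts contribute products within \<open>L 5\<close> and
      within \<open>L 2\<close>, which lie in \<open>L 4\<close> and drop out of the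
      \<open>L 6\<close> component.\<close>
    have 4: "br (P y) z \<in> L 4" "br y (Q z) \<in> L 4"
      by (rule br_mem[OF product_spans(4)[of 5] P5 yz(2)], simp)
        (rule br_mem[OF product_spans(4)[of 2] yz(1) Q2], simp)
    have "T (br y z) = scl (\<alpha> + \<delta>) (br y z) + (br (P y) z + br y (Q z))"
      using yz by (simp add: der T2 T5 bilinear N.scale_left_distrib add_ac)
    then have "M.proj 6 (T (br y z)) = scl (\<alpha> + \<delta>) (br y z)"
      using M.proj_L[OF 4(1) i(4,6)] M.proj_L[OF 4(2) i(4,6)] M.proj_L[OF yz6 i(6,6)]
      by (simp add: proj6)
    then show "T (br y z) = scl (3 * a) (br y z)"
      using T_component_scalar[OF _ yz6] by (simp add: \<alpha> \<delta>)
  qed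
  have Tk: "T x = scl (3 * a / 2) x" if k: "k \<in> {7..n}" and x: "x \<in> L k" for k x
  proof -
    have "k \<in> {1..n}" using k by auto
    then obtain c where c: "\<And>x. x \<in> L k \<Longrightarrow> M.proj k (T x) = scl c x"
      using M.equivariant_scalar_component[OF T] by blast
    then have c': "T x = scl c x" if "x \<in> L k" for x
      using T_component_scalar[of k x] k that by simp
    have "3 * a = 2 * c"
      using k c' M.submodule_L(1)[OF i(6)]
      by (intro T_on_square[of k "3 * a" c "\<lambda>_. 0"] T4 product_spans(4)) auto
    then have "c = 3 * a / 2" by simp
    then show ?thesis using c' x by simp
  qed
  \<comment> \<open>\<open>T\<close> scales \<open>L 4\<close> by 3a and \<open>L 1\<close> by a, so
    the Leibniz rule leaves 2a for the second factor, modulo the centralizer of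
    \<open>L 1\<close>.\<close>
  have centralizing: "br x (T y - scl (2 * a) y) = 0" if "k \<in> {2, 5}" "y \<in> L k" "x \<in> L 1" for k x y
  proof -
    have "br x y \<in> L 4" by (rule br_mem[OF product_spans(3) that(3,2)]) (use that in auto)
    then have "scl (3 * a) (br x y) = scl a (br x y) + br x (T y)"
      using der[of x y] T4 T1[OF that(3)] by (simp add: bilinear)
    moreover have "scl (3 * a) (br x y) = scl a (br x y) + scl (2 * a) (br x y)"
      by (simp add: N.scale_left_distrib[symmetric])
    ultimately show ?thesis by (simp add: N.br_diff_right bilinear)
  qed
  have T2': "T y - scl (2 * a) y = P y - scl (a / 2) y" if "y \<in> L 2" for y
  proof -
    have "scl (2 * a) y = scl \<alpha> y + scl (a / 2) y"
      unfolding N.scale_left_distrib[symmetric] by (simp add: \<alpha> field_simps)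
    then show ?thesis using T2[OF that] by simp
  qed
  have T5': "T y - scl (2 * a) y = Q y - scl (a / 2) y" if "y \<in> L 5" for y
  proof -
    have "scl (2 * a) y = scl \<delta> y + scl (a / 2) y"
      unfolding N.scale_left_distrib[symmetric] by (simp add: \<delta> field_simps)
    then show ?thesis using T5[OF that] by simp
  qed
  have "a = 0"
  proof (rule ccontr)
    assume "a \<noteq> 0"
    obtain y1 where y1: "y1 \<in> L 2" "y1 \<noteq> 0"
      using M.irrep_nonzero[OF M.irreps[OF i(2)]] by blast
    \<comment> \<open>Otherwise (a/2) \<open>y1\<close> would centralize \<open>L 1\<close>. Hence
      \<open>P\<close> maps onto the irreducible module \<open>L 5\<close>.\<close>
    have "P y1 \<noteq> 0"
    proof
      assume "P y1 = 0"
      then have "br x y1 = 0" if "x \<in> L 1" for x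
        using centralizing[of 2 y1 x] T2'[OF y1(1)] y1(1) that \<open>a \<noteq> 0\<close>
        by (simp add: N.br_minus_right bilinear)
      then show False using centralizer_of_L1[of 2 y1] y1 by simp
    qed
    then have PL: "P ` L 2 = L 5"
      by (intro M.equivariant_surj[OF P M.irreps[OF i(2)] M.irreps[OF i(5)] P5 y1(1)])
    \<comment> \<open>By Schur's lemma \<open>Q\<close> after \<open>P\<close> is a scalar. Each of
      the two acts like a/2 inside brackets with \<open>L 1\<close>, which forces \<kappa> =
      (a/2)^2.\<close>
    obtain \<kappa> where \<kappa>: "\<And>y. y \<in> L 2 \<Longrightarrow> Q (P y) = scl \<kappa> y"
      using M.schur_scalar[OF M.equivariant_comp[OF Q P] M.irreps[OF i(2)] Q2] by blast
    have "br x (scl (\<kappa> - a / 2 * (a / 2)) y1) = 0" if x: "x \<in> L 1" for x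
    proof -
      have 1: "br x (P y1) = scl (a / 2) (br x y1)"
        using centralizing[of 2 y1 x] T2'[OF y1(1)] y1(1) x by (simp add: N.br_diff_right bilinear)
      have "scl \<kappa> (br x y1) = scl (a / 2) (br x (P y1))"
        using centralizing[of 5 "P y1" x] T5'[OF P5] P5 \<kappa>[OF y1(1)] x
        by (simp add: N.br_diff_right bilinear)
      then show ?thesis
        unfolding 1 by (auto simp: bilinear field_simps)
    qed
    then have "scl (\<kappa> - a / 2 * (a / 2)) y1 = 0"
      by (intro centralizer_of_L1[OF _ M.submodule_L(2)[OF i(2) y1(1)]]) simp
    then have \<kappa>a: "\<kappa> = a / 2 * (a / 2)" using y1(2) by simp
    \<comment> \<open>A vector of \<open>L 2\<close> plus \<open>L 5\<close> centralized by
      \<open>L 1\<close> has the form \<open>P w\<close> - (a/2) \<open>w\<close>; with the value of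
      \<kappa> this is an eigenvector of \<open>T\<close> for a.\<close>
    have TC: "T u = scl a u"
      if u: "u = y + z" "y \<in> L 2" "z \<in> L 5" and c: "\<And>x. x \<in> L 1 \<Longrightarrow> br x u = 0" for u y z
    proof -
      obtain w where w: "w \<in> L 2" "z = P w" using u(3) PL by auto
      have "br x (y + scl (a / 2) w) = 0" if x: "x \<in> L 1" for x
        using centralizing[of 2 w x] T2'[OF w(1)] w(1) x c[OF x]
        by (simp add: N.br_diff_right bilinear u(1) w(2))
      then have "y + scl (a / 2) w = 0"
        by (intro centralizer_of_L1[OF _ M.submodule_L(3)[OF i(2) u(2) M.submodule_L(2)[OF i(2) w(1)]]]) simp
      then have y: "y = - scl (a / 2) w" by (simp add: eq_neg_iff_add_eq_0)
      have "T (y + z) = T z - scl (a / 2) (T w)"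
        using eqT(1)[of "y + z" "scl (a / 2) w"] by (simp add: y eqT(2))
      also have "\<dots> = scl (\<kappa> - a / 2 * \<alpha>) w + scl (\<delta> - a / 2) z"
        using T5[of z] T2[OF w(1)] u(3) \<kappa>[OF w(1)]
        by (simp add: w(2) N.scale_left_diff_distrib N.scale_right_distrib)
      also have "\<kappa> - a / 2 * \<alpha> = - (a * (a / 2))" by (simp add: \<kappa>a \<alpha> field_simps)
      also have "\<delta> - a / 2 = a" by (simp add: \<delta> field_simps)
      finally show ?thesis by (simp add: u(1) y N.scale_right_distrib N.scale_right_diff_distrib)
    qed
    obtain u v y z y' z' where u: "u = y + z" "y \<in> L 2" "z \<in> L 5" "\<And>x. x \<in> L 1 \<Longrightarrow> br x u = 0"
      and v: "v = y' + z'" "y' \<in> L 2" "z' \<in> L 5" "\<And>x. x \<in> L 1 \<Longrightarrow> br x v = 0" and uv: "br u v \<noteq> 0"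
      using nondegenerate unfolding nondegenerate_products_def Let_def centralizer_def by blast
    have "T (br u v) = scl (2 * a) (br u v)"
      using TC[OF u] TC[OF v] by (simp add: der bilinear N.scale_left_distrib[symmetric])
    \<comment> \<open>All four parts of \<open>br u v\<close> lie in \<open>L 4\<close> or
      \<open>L 6\<close>, where \<open>T\<close> is 3a; comparison with 2a contradicts a \<noteq>
      0.\<close>
    moreover have "T (br u v) = scl (3 * a) (br u v)"
    proof -
      have "T (br y y') = scl (3 * a) (br y y')" "T (br z z') = scl (3 * a) (br z z')"
        using br_mem[OF product_spans(4)[of 2] u(2) v(2)] br_mem[OF product_spans(4)[of 5] u(3) v(3)] T4
        by simp_all
      moreover have "T (br y z') = scl (3 * a) (br y z')" "T (br z y') = scl (3 * a) (br z y')"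
        using br_mem[OF product_spans(2) u(2) v(3)] br_mem_swap[OF product_spans(2) i(6) u(3) v(2)] T6
        by simp_all
      ultimately show ?thesis
        by (simp add: u(1) v(1) N.br_add_left N.br_add_right eqT(1) N.scale_right_distrib)
    qed
    ultimately have "scl (2 * a) (br u v) = scl (3 * a) (br u v)" by simp
    then show False using uv \<open>a \<noteq> 0\<close> by (simp only: N.scale_cancel_right) simp
  qed
  \<comment> \<open>For a = 0, \<open>T y\<close> itself centralizes \<open>L 1\<close>, and it
    equals \<open>P y\<close> because the diagonal scalar is 0.\<close>
  have "P y = 0" if "y \<in> L 2" for y
  proof (rule centralizer_of_L1[of 5, OF _ P5])
    show "br x (P y) = 0" if "x \<in> L 1" for x
      using centralizing[of 2 y x] T2'[OF \<open>y \<in> L 2\<close>] that \<open>y \<in> L 2\<close> \<open>a = 0\<close> by simp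
  qed simp
  then have T2_zero: "T y = 0" if "y \<in> L 2" for y
    using T2[OF that] that \<open>a = 0\<close> \<alpha> by simp
  have "Q y = 0" if "y \<in> L 5" for y
  proof (rule centralizer_of_L1[of 2, OF _ Q2])
    show "br x (Q y) = 0" if "x \<in> L 1" for x
      using centralizing[of 5 y x] T5'[OF \<open>y \<in> L 5\<close>] that \<open>y \<in> L 5\<close> \<open>a = 0\<close> by simp
  qed simp
  then have T5_zero: "T y = 0" if "y \<in> L 5" for y
    using T5[OF that] that \<open>a = 0\<close> \<delta> by simp
  have T_L: "T y = 0" if "k \<in> {1..n}" "y \<in> L k" for k y
  proof -
    have "k \<in> {1, 2, 3, 4, 5, 6} \<or> k \<in> {7..n}" using that(1) by auto
    then show ?thesis
      using T1[of y] T2_zero[of y] T3[of y] T4[of y] T5_zero[of y] T6[of y] Tk[of k y] that(2) \<open>a = 0\<close>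
      by auto
  qed
  show ?thesis
    by (rule M.additive_eq_0[of T, OF eqT(1) T_L])
qed

end

end

section \<open>The semidirect product\<close>

interpretation adjoint: sl2_module sl2_scale sl2_bracket
  by unfold_locales
    (simp_all add: sl2.br_add_left sl2.br_add_right sl2.br_scale_left sl2.br_scale_right sl2.br_br_left)

text \<open>8 is l(l + 2) for l = 2. The vector \<open>sl2_e\<close> is primitive of weight 2, and
  brackets with \<open>sl2_f\<close> and \<open>sl2_h\<close> lead from it to multiples of
  \<open>sl2_h\<close> and \<open>sl2_f\<close>, preserving the eigenvalue.\<close>

lemma casimir_adjoint: "adjoint.casimir x = sl2_scale 8 x"
proof -
  have e: "adjoint.casimir sl2_e = sl2_scale 8 sl2_e"
    using adjoint.casimir_primitive[of sl2_e 2] by (simp add: sl2.br_self sl2_relations)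
  have act: "adjoint.casimir (sl2_bracket a y) = sl2_scale 8 (sl2_bracket a y)"
    if "adjoint.casimir y = sl2_scale 8 y" for a y
    by (simp only: adjoint.casimir_act that sl2.br_scale_right)
  have scale: "adjoint.casimir (sl2_scale c y) = sl2_scale 8 (sl2_scale c y)"
    if "adjoint.casimir y = sl2_scale 8 y" for c y
    unfolding adjoint.casimir_scale that by (rule sl2.scale_left_commute)
  have "sl2_h = sl2_scale (-1) (sl2_bracket sl2_f sl2_e)"
    using sl2.br_swap[of sl2_e sl2_f] by (simp add: sl2_relations)
  then have h: "adjoint.casimir sl2_h = sl2_scale 8 sl2_h"
    using scale[OF act[OF e]] by metis
  have "sl2_bracket sl2_f sl2_h = sl2_scale 2 sl2_f"
    by (subst sl2.br_swap) (simp add: sl2_relations)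
  then have "sl2_f = sl2_scale (1 / 2) (sl2_bracket sl2_f sl2_h)"
    by simp
  then have f: "adjoint.casimir sl2_f = sl2_scale 8 sl2_f"
    using scale[OF act[OF h]] by metis
  obtain \<alpha> \<beta> \<gamma> where "x = sl2_scale \<alpha> sl2_e + sl2_scale \<beta> sl2_h + sl2_scale \<gamma> sl2_f"
    using sl2_expand by blast
  then show ?thesis
    by (simp only: adjoint.casimir_add scale e f h sl2.scale_right_distrib)
qed

context sl2_example
begin

sublocale G: lie_algebra "semidirect_scale sl2_scale scl" "semidirect_bracket sl2_bracket act br"
  by (rule semidirect_lie_algebra)

abbreviation "gbr \<equiv> semidirect_bracket sl2_bracket act br"

lemma gscale: "semidirect_scale sl2_scale scl c (a, x) = (sl2_scale c a, scl c x)"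
proof -
  interpret V: vector_space_prod sl2_scale scl by unfold_locales
  show ?thesis by (rule V.scale_prod)
qed

lemma act_zero_left [simp]: "act 0 x = 0"
  using act_add_left[of 0 0 x] by simp

lemma sl2_bracket_zero [simp]: "sl2_bracket 0 a = 0" "sl2_bracket a 0 = 0"
  using sl2.br_add_left[of 0 0 a] sl2.br_add_right[of a 0 0] by simp_all

lemma gbr_simps:
  "gbr (a, x) (b, y) = (sl2_bracket a b, act a y - act b x + br x y)"
  by (simp add: semidirect_bracket_def)

text \<open>The sl2-component \<open>\<psi>\<close> of \<open>D\<close> on the ideal is equivariant
  into the adjoint module, of highest weight 2, so Casimir eigenvalues make it vanish off
  \<open>L 4\<close>. It also kills products, and \<open>L 4\<close> is spanned by products of
  \<open>L 1\<close> and \<open>L 3\<close>. What remains is an equivariant derivation, covered by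
  \<open>T_zero\<close>.\<close>

lemma derivation_killing_sl2:
  assumes add: "\<And>p q. D (p + q) = D p + D q"
    and scale: "\<And>c p. D (semidirect_scale sl2_scale scl c p) = semidirect_scale sl2_scale scl c (D p)"
    and der: "\<And>p q. D (gbr p q) = gbr (D p) q + gbr p (D q)"
    and sl2: "\<And>a. D (a, 0) = 0"
  shows "D p = 0"
proof -
  define \<psi> where "\<psi> x = fst (D (0, x))" for x
  define T where "T x = snd (D (0, x))" for x
  have D: "D (0, x) = (\<psi> x, T x)" for x by (simp add: \<psi>_def T_def)
  have D_add: "\<psi> (x + y) = \<psi> x + \<psi> y" "T (x + y) = T x + T y" for x y
    using add[of "(0, x)" "(0, y)"] by (simp_all add: D)
  have D_scale: "\<psi> (scl c x) = sl2_scale c (\<psi> x)" "T (scl c x) = scl c (T x)" for c x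
    using scale[of c "(0, x)"] by (simp_all add: D gscale)
  have D_act: "\<psi> (act a x) = sl2_bracket a (\<psi> x)" "T (act a x) = act a (T x)" for a x
    using der[of "(a, 0)" "(0, x)"] by (simp_all add: D gbr_simps sl2 zero_prod_def)
  have D_br: "\<psi> (br x y) = 0"
    "T (br x y) = act (\<psi> x) y + br (T x) y + (br x (T y) - act (\<psi> y) x)" for x y
    using der[of "(0, x)" "(0, y)"] by (simp_all add: D gbr_simps algebra_simps)
  have \<psi>0: "\<psi> 0 = 0" using D_add(1)[of 0 0] by simp
  have i4: "4 \<in> {1..n}" using n by simp
  have \<psi>_L: "\<psi> x = 0" if i: "i \<in> {1..n}" and x: "x \<in> L i" for i x
  proof (cases "highest_weights r i = 2")
    case True
    then have "i = 4" using weights_distinct[OF i i4] by (auto simp: weights doubleton_eq_iff)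
    then have "x \<in> N.span {br u v |u v. u \<in> L 1 \<and> v \<in> L 3}"
      using x product_spans(3)[of 3] by (simp add: product_span_def)
    then show ?thesis
      by (induction rule: N.span_induct_alt) (auto simp: \<psi>0 D_add D_scale D_br)
  next
    case False
    let ?c = "of_nat (highest_weights r i * (highest_weights r i + 2)) :: complex"
    have "\<psi> (M.casimir x) = adjoint.casimir (\<psi> x)"
      by (simp add: M.casimir_def adjoint.casimir_def D_add D_scale D_act)
    then have "sl2_scale ?c (\<psi> x) = sl2_scale 8 (\<psi> x)"
      by (simp only: M.casimir_irrep[OF M.irreps[OF i] x] D_scale casimir_adjoint)
    moreover have "?c \<noteq> 8"
    proof
      assume "?c = 8"
      then have "?c = of_nat (2 * (2 + 2))" by simp
      then show False using False by (simp only: of_nat_eq_iff M.weight_eq_iff)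
    qed
    ultimately show ?thesis by (simp only: sl2.scale_cancel_right) blast
  qed
  have \<psi>: "\<psi> x = 0" for x
    by (rule M.additive_eq_0[of \<psi>, OF D_add(1) \<psi>_L])
  \<comment> \<open>With \<open>\<psi>\<close> zero, the second part of \<open>D_br\<close> is the
    Leibniz rule for \<open>T\<close>.\<close>
  have "T x = 0" for x
    by (rule T_zero) (simp_all add: M.equivariant_def D_add D_scale D_act D_br \<psi>)
  then have "D (0, x) = 0" for x by (simp add: D \<psi> zero_prod_def)
  then show ?thesis
    using add[of "(fst p, 0)" "(0, snd p)"] sl2[of "fst p"] by simp
qed

lemma derivations_inner:
  assumes "derivation (semidirect_scale sl2_scale scl) gbr D"
  shows "inner_derivation gbr D"
proof -
  have add: "D (p + q) = D p + D q"
    and scale: "D (semidirect_scale sl2_scale scl c p) = semidirect_scale sl2_scale scl c (D p)"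
    and der: "D (gbr p q) = gbr (D p) q + gbr p (D q)" for p q c
    using assms unfolding derivation_def Vector_Spaces.linear_iff by blast+
  define \<delta> where "\<delta> a = fst (D (a, 0))" for a
  define \<phi> where "\<phi> a = snd (D (a, 0))" for a
  have D: "D (a, 0) = (\<delta> a, \<phi> a)" for a by (simp add: \<delta>_def \<phi>_def)
  have D_add: "\<delta> (a + b) = \<delta> a + \<delta> b" "\<phi> (a + b) = \<phi> a + \<phi> b" for a b
    using add[of "(a, 0)" "(b, 0)"] by (simp_all add: D)
  have D_scale: "\<delta> (sl2_scale c a) = sl2_scale c (\<delta> a)" "\<phi> (sl2_scale c a) = scl c (\<phi> a)" for c a
    using scale[of c "(a, 0)"] by (simp_all add: D gscale)
  have D_br: "\<delta> (sl2_bracket a b) = sl2_bracket a (\<delta> b) - sl2_bracket b (\<delta> a)"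
    "\<phi> (sl2_bracket a b) = act a (\<phi> b) - act b (\<phi> a)" for a b
    using der[of "(a, 0)" "(b, 0)"] sl2.br_swap[of b "\<delta> a"] by (simp_all add: D gbr_simps)
  \<comment> \<open>\<open>\<delta>\<close> is a derivation of sl2, hence a cocycle for the adjoint
    module, whose Casimir eigenvalue is 8.\<close>
  obtain y where y: "\<And>a. \<delta> a = sl2_bracket a y"
    using adjoint.cocycle_is_coboundary[OF D_add(1) D_scale(1) D_br(1) casimir_adjoint] by auto
  obtain x where x: "\<And>a. \<phi> a = act a x"
    using M.whitehead[OF D_add(2) D_scale(2) D_br(2)] by auto
  \<comment> \<open>On (a, 0), \<open>gbr (y, x)\<close> is minus the pair of
    \<open>sl2_bracket a y\<close> and \<open>act a x\<close>, so adding it cancels \<open>D\<close>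
    there.\<close>
  define D' where "D' p = D p + gbr (y, x) p" for p
  have "D' p = 0" for p
  proof (rule derivation_killing_sl2[where D = D'])
    show "D' (p + q) = D' p + D' q" for p q
      by (simp add: D'_def add G.br_add_right)
    show "D' (semidirect_scale sl2_scale scl c p) = semidirect_scale sl2_scale scl c (D' p)" for c p
      by (simp add: D'_def scale G.br_scale_right G.scale_right_distrib)
    show "D' (gbr p q) = gbr (D' p) q + gbr p (D' q)" for p q
    proof -
      have "gbr (y, x) (gbr p q) = gbr (gbr (y, x) p) q + gbr p (gbr (y, x) q)"
        by (simp add: G.br_br_left)
      then show ?thesis
        by (simp add: D'_def der G.br_add_left G.br_add_right)
    qed
    show "D' (a, 0) = 0" for a
      using sl2.br_swap[of a y] by (simp add: D'_def D y x gbr_simps zero_prod_def)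
  qed
  then have "D p = gbr (- (y, x)) p" for p
    by (simp only: D'_def eq_neg_iff_add_eq_0 G.br_minus_left)
  then show ?thesis unfolding inner_derivation_def by blast
qed

text \<open>\<open>L 6\<close> is a trivial module and 6 occurs as an index in no listed pair, so
  its vectors commute with everything.\<close>

lemma center_nontrivial: "lie_center gbr \<noteq> {0}"
proof -
  have i: "6 \<in> {1..n}" using n by simp
  obtain z where z: "z \<in> L 6" "z \<noteq> 0"
    using M.irrep_nonzero[OF M.irreps[OF i]] by blast
  have "br z x = 0" if "x \<in> L j" "j \<in> {1..n}" for x j
  proof -
    have "(6, j) \<notin> nonzero_products n \<and> (j, 6) \<notin> nonzero_products n"
      by (auto simp: nonzero_products_def)
    then show ?thesis
      using products that z(1) i unfolding prescribed_products_def by blast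
  qed
  then have "br z x = 0" for x
    by (rule M.additive_eq_0[of "br z", OF N.br_add_right])
  moreover have "act a z = 0" for a
    using M.trivial_irrep[OF _ z(1)] M.irreps[OF i] by (simp add: weights)
  ultimately have "(0, z) \<in> lie_center gbr"
    by (simp add: lie_center_def gbr_simps zero_prod_def)
  then show ?thesis using z(2) by (auto simp: zero_prod_def)
qed

end

theorem theorem4p8:
  fixes n :: nat and r :: "nat \<Rightarrow> nat"
    and scl :: "complex \<Rightarrow> 'n::ab_group_add \<Rightarrow> 'n"
    and br :: "'n \<Rightarrow> 'n \<Rightarrow> 'n"
    and act :: "sl2 \<Rightarrow> 'n \<Rightarrow> 'n"
    and L :: "nat \<Rightarrow> 'n set"
  assumes "n \<ge> 6"
    and "\<forall>j\<in>{7..n}. r j \<ge> 4"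
    and "inj_on r {7..n}"
    and "lie_action_by_derivations sl2_scale sl2_bracket scl br act"
    and "internal_direct_sum n L"
    and "\<forall>i\<in>{1..n}. irreducible_of_highest_weight scl act (highest_weights r i) (L i)"
    and "prescribed_products scl br n L"
    and "nondegenerate_products br L"
  shows "(\<forall>D. derivation (semidirect_scale sl2_scale scl) (semidirect_bracket sl2_bracket act br) D
              \<longrightarrow> inner_derivation (semidirect_bracket sl2_bracket act br) D)
         \<and> lie_center (semidirect_bracket sl2_bracket act br) \<noteq> {0}"
proof -
  interpret sl2_example scl br act n r L
    using assms by (intro sl2_example.intro sl2_example_axioms.intro)
  show ?thesis
    using derivations_inner center_nontrivial by blast
qed

end
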